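(* Let $q$ be a prime power. Then $\mathrm{SL}(2,q)$, in its natural action on $\mathbb{F}_q^2\setminus\{0\}$, contains a sharply transitive subset if and only if $q\in\{2,3,5,7,11\}$.
   Context: Let $G$ be a transitive permutation group on a finite set $\Omega$. A subset $S\subseteq G$ is called sharply transitive (on $\Omega$) if for every ordered pair $(\alpha,\beta)\in\Omega\times\Omega$ there is a unique element $s\in S$ mapping $\alpha$ to $\beta$. Here $G=\mathrm{SL}(2,q)$ acts on the set of nonzero vectors $\mathbb{F}_q^2\setminus\{0\}$ by matrix multiplication. *)

theory Defs
  imports
    "HOL-Analysis.Analysis"
    "HOL-Algebra.Group_Action"
    "HOL-Number_Theory.Prime_Powers"
begin

definition SL2 :: "('k::field ^ 2 ^ 2) monoid" where
  "SL2 = \<lparr>carrier = {A. det A = 1}, mult = (**), one = mat 1\<rparr>"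

definition nonzero_vectors :: "('k::field ^ 2) set" where
  "nonzero_vectors = {v. v \<noteq> 0}"

text \<open>The theory of group actions in HOL-Algebra uses extensional permutations, hence the
  restriction to the set of nonzero vectors.\<close>

definition natural_action :: "'k::field ^ 2 ^ 2 \<Rightarrow> 'k ^ 2 \<Rightarrow> 'k ^ 2" where
  "natural_action A = (\<lambda>v \<in> nonzero_vectors. A *v v)"

definition sharply_transitive ::
    "('g, 'm) monoid_scheme \<Rightarrow> 'x set \<Rightarrow> ('g \<Rightarrow> 'x \<Rightarrow> 'x) \<Rightarrow> 'g set \<Rightarrow> bool" where
  "sharply_transitive G E \<phi> S \<longleftrightarrow>
     S \<subseteq> carrier G \<and> (\<forall>\<alpha>\<in>E. \<forall>\<beta>\<in>E. \<exists>!s. s \<in> S \<and> \<phi> s \<alpha> = \<beta>)"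

lemma SL2_simps [simp]:
  "A \<in> carrier SL2 \<longleftrightarrow> det A = 1"
  "A \<otimes>\<^bsub>SL2\<^esub> B = A ** B"
  "\<one>\<^bsub>SL2\<^esub> = mat 1"
  by (simp_all add: SL2_def)

lemma SL2_inverse:
  fixes A :: "'k::field ^ 2 ^ 2"
  assumes "det A = 1"
  obtains B where "det B = 1" "B ** A = mat 1" "A ** B = mat 1"
proof -
  from assms have "invertible A" by (simp add: invertible_det_nz)
  then obtain B where B: "A ** B = mat 1" "B ** A = mat 1" by (auto simp: invertible_def)
  then have "det (A ** B) = 1" by (simp add: det_I)
  with assms have "det B = 1" by (simp add: det_mul)
  with B show thesis using that by blast
qed

lemma group_SL2: "group (SL2 :: ('k::field ^ 2 ^ 2) monoid)"
proof (rule groupI)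
  fix A :: "'k ^ 2 ^ 2" assume "A \<in> carrier SL2"
  then have "det A = 1" by simp
  then obtain B where "det B = 1" "B ** A = mat 1" by (rule SL2_inverse)
  then show "\<exists>B \<in> carrier SL2. B \<otimes>\<^bsub>SL2\<^esub> A = \<one>\<^bsub>SL2\<^esub>"
    by auto
qed (auto simp: det_mul matrix_mul_assoc det_I)

lemma SL2_nonzero:
  fixes A :: "'k::field ^ 2 ^ 2"
  assumes "det A = 1"
  shows "A *v v = 0 \<longleftrightarrow> v = 0"
proof -
  obtain B where "B ** A = mat 1" using SL2_inverse[OF assms] by blast
  then have "B *v (A *v v) = v" by (simp add: matrix_vector_mul_assoc)
  then show ?thesis by (metis matrix_vector_mult_0_right)
qed

lemma natural_action_Bij:
  fixes A :: "'k::field ^ 2 ^ 2"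
  assumes "det A = 1"
  shows "natural_action A \<in> Bij nonzero_vectors"
proof -
  obtain B where B: "det B = 1" "B ** A = mat 1" "A ** B = mat 1"
    using SL2_inverse[OF assms] by blast
  have "bij_betw (natural_action A) nonzero_vectors nonzero_vectors"
    by (rule bij_betw_byWitness[where f' = "natural_action B"])
      (auto simp: natural_action_def nonzero_vectors_def SL2_nonzero assms B
        matrix_vector_mul_assoc)
  then show ?thesis by (simp add: Bij_def natural_action_def)
qed

lemma SL2_first_column:
  fixes v :: "'k::field ^ 2"
  assumes "v \<noteq> 0"
  shows "\<exists>A :: 'k ^ 2 ^ 2. det A = 1 \<and> A *v axis 1 1 = v"
proof (cases "v $ 1 = 0")
  case True
  with assms have "v $ 2 \<noteq> 0" by (auto simp: vec_eq_iff forall_2)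
  with True show ?thesis
    by (intro exI[of _ "vector [vector [v $ 1, - inverse (v $ 2)], vector [v $ 2, 0]]"])
      (simp add: det_2 vec_eq_iff forall_2 matrix_vector_mult_def sum_2 axis_def)
next
  case False
  then show ?thesis
    by (intro exI[of _ "vector [vector [v $ 1, 0], vector [v $ 2, inverse (v $ 1)]]"])
      (simp add: det_2 vec_eq_iff forall_2 matrix_vector_mult_def sum_2 axis_def)
qed

lemma transitive_action_SL2:
  "transitive_action (SL2 :: ('k::field ^ 2 ^ 2) monoid) nonzero_vectors natural_action"
proof (intro transitive_action.intro group_action.intro transitive_action_axioms.intro)
  have "natural_action \<in> hom (SL2 :: ('k ^ 2 ^ 2) monoid) (BijGroup nonzero_vectors)"
  proof (rule homI)
    fix A B :: "'k ^ 2 ^ 2" assume "A \<in> carrier SL2" "B \<in> carrier SL2"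
    then have det: "det A = 1" "det B = 1" by simp_all
    have "natural_action (A ** B) = compose nonzero_vectors (natural_action A) (natural_action B)"
    proof (rule ext)
      fix v :: "'k ^ 2"
      have "B *v v \<in> nonzero_vectors" if "v \<in> nonzero_vectors"
        using that det SL2_nonzero[of B v] by (simp add: nonzero_vectors_def)
      then show "natural_action (A ** B) v =
          compose nonzero_vectors (natural_action A) (natural_action B) v"
        by (simp add: natural_action_def compose_def matrix_vector_mul_assoc)
    qed
    with det show "natural_action (A \<otimes>\<^bsub>SL2\<^esub> B) =
        natural_action A \<otimes>\<^bsub>BijGroup nonzero_vectors\<^esub> natural_action B"
      by (simp add: BijGroup_def natural_action_Bij)
  qed (simp add: BijGroup_def natural_action_Bij)
  then show "group_hom (SL2 :: ('k ^ 2 ^ 2) monoid) (BijGroup nonzero_vectors) natural_action"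
    by (simp add: group_hom_def group_hom_axioms_def group_SL2 group_BijGroup)
next
  fix x y :: "'k ^ 2" assume xy: "x \<in> nonzero_vectors" "y \<in> nonzero_vectors"
  obtain A B :: "'k ^ 2 ^ 2" where A: "det A = 1" "A *v axis 1 1 = x"
    and B: "det B = 1" "B *v axis 1 1 = y"
    using SL2_first_column xy unfolding nonzero_vectors_def by blast
  obtain C where C: "det C = 1" "C ** A = mat 1" using SL2_inverse[OF A(1)] by blast
  have "(B ** C) *v x = (B ** (C ** A)) *v axis 1 1"
    by (simp add: A(2)[symmetric] matrix_vector_mul_assoc matrix_mul_assoc)
  then have "(B ** C) *v x = y" using B C by simp
  then show "\<exists>g \<in> carrier SL2. natural_action g x = y"
    using xy B C by (intro bexI[of _ "B ** C"]) (auto simp: natural_action_def det_mul)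
qed

lemma faithful_action_SL2:
  "faithful_action (SL2 :: ('k::field ^ 2 ^ 2) monoid) nonzero_vectors natural_action"
proof -
  interpret transitive_action "SL2 :: ('k ^ 2 ^ 2) monoid" nonzero_vectors natural_action
    by (rule transitive_action_SL2)
  show ?thesis
  proof
    show "inj_on natural_action (carrier (SL2 :: ('k ^ 2 ^ 2) monoid))"
    proof (rule inj_onI)
      fix A B :: "'k ^ 2 ^ 2" assume eq: "natural_action A = natural_action B"
      have "A *v v = B *v v" for v
        using fun_cong[OF eq, of v]
        by (cases "v = 0") (auto simp: natural_action_def nonzero_vectors_def)
      then show "A = B" by (simp add: matrix_eq)
    qed
  qed
qed

end

theory Submission
  imports Defs "HOL-Algebra.Algebraic_Closure_Type"
begin

text \<open>
  Write \<open>q\<close> for the number of elements of the field and let \<open>S\<close> be a sharply transitive subset of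
  \<open>SL(2,q)\<close>. Two distinct elements \<open>s\<close>, \<open>t\<close> of \<open>S\<close> never agree on a nonzero vector, so
  \<open>det (s - t) \<noteq> 0\<close>, and \<open>S\<close> has \<open>q\<^sup>2 - 1\<close> elements. Right translates of \<open>S\<close> by elements of
  \<open>SL(2,q)\<close> are again sharply transitive. Call \<open>x\<close> elliptic if \<open>w\<^sup>2 - x w + 1\<close> has no root in the
  field; there are at least \<open>(q - 1) / 2\<close> such \<open>x\<close> (\<open>card_elliptic\<close>). The obstruction comes from two
  opposing facts about the number \<open>N\<close> of elements of trace \<open>x\<close> in a translate of \<open>S\<close>.

  The first is a congruence: \<open>N\<close> equals \<open>x\<^sup>2 - 3\<close> in the field (\<open>elliptic_trace_count\<close>). For
  every \<open>2 \<times> 2\<close> matrix \<open>D\<close>, counting the pairs \<open>(s, v)\<close> with \<open>s v = D v\<close> gives the number of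
  \<open>s \<in> S\<close> with \<open>det (s - D) = 0\<close> modulo the characteristic. For \<open>D\<close> diagonal with entries \<open>y\<close>, \<open>z\<close> this
  reads \<open>\<Sum>\<^sub>s det (s - D)\<^sup>q\<^sup>-\<^sup>1 = -1 - (y z)\<^sup>q\<^sup>-\<^sup>1\<close>. Both sides have degree below \<open>q\<close> in \<open>y\<close> and in
  \<open>z\<close>, so the identity persists over the algebraic closure, where \<open>y\<close> and \<open>z\<close> can both be a root \<open>l\<close>
  of \<open>w\<^sup>2 - x w + 1\<close>. Then \<open>det (s - D) = l (x - trace s)\<close> and \<open>l\<^sup>q = 1 / l\<close>, and the congruence
  drops out. It already forces \<open>q\<close> to be prime: \<open>x\<^sup>2\<close> lies in the prime field for all elliptic \<open>x\<close>,
  and a proper extension has too many elliptic elements for that (\<open>sharp_imp_prime_CARD\<close>).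

  The second is a variance bound: as \<open>M\<close> runs through \<open>SL(2,q)\<close>, the number \<open>N M\<close> of \<open>s \<in> S\<close>
  with \<open>trace (s M) = x\<close> has mean \<open>q - 1\<close> and variance at most \<open>3 (q - 1)\<close> (\<open>first_moment\<close>,
  \<open>second_moment\<close>). The second moment counts, for \<open>u = s t\<^sup>-\<^sup>1\<close>, the matrices \<open>M\<close> with
  \<open>trace M = trace (u M) = x\<close>. For \<open>u \<noteq> 1\<close> they form a conic whose number of points is at most
  \<open>q + 1\<close> minus the number of eigenlines of \<open>u\<close> (\<open>conic_bound\<close>), and the eigenlines can be
  counted over all of \<open>S t\<^sup>-\<^sup>1\<close> because that set is sharply transitive.

  When \<open>q = p\<close> is prime, the congruence confines \<open>N M\<close> to one residue class \<open>r\<close> modulo \<open>p\<close>, so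
  \<open>(N M - r) (N M - r - p) \<ge> 0\<close>. Averaging gives \<open>r (p - 2 - r) \<le> 2 (p - 1)\<close>
  (\<open>elliptic_residue_bound\<close>), which fails unless \<open>x\<^sup>2\<close> is one of a few fixed small numbers. For
  \<open>p \<ge> 29\<close> some elliptic \<open>x\<close> escapes these exceptions by counting, and for \<open>13 \<le> p \<le> 23\<close> an
  explicit \<open>x\<close> does.

  In the five remaining cases a sharply transitive set is written down as a union of cosets of the
  diagonal torus (\<open>sharp_if_transversal\<close>), and checking it is a finite computation.\<close>

no_notation fps_nth (infixl "$" 75)
hide_const (open) Polynomials.degree up_ring.coeff up_ring.monom Divisibility.prime

section \<open>Sharply transitive subsets of the special linear group\<close>

lemma sharply_transitive_SL2_iff:
  "sharply_transitive (SL2 :: ('k::field ^ 2 ^ 2) monoid) nonzero_vectors natural_action S \<longleftrightarrow>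
    (\<forall>s\<in>S. det s = 1) \<and>
    (\<forall>v w. v \<noteq> 0 \<longrightarrow> w \<noteq> 0 \<longrightarrow> (\<exists>!s. s \<in> S \<and> s *v v = w))"
  by (auto simp: sharply_transitive_def natural_action_def nonzero_vectors_def)

abbreviation sharp :: "('k::field ^ 2 ^ 2) set \<Rightarrow> bool" where
  "sharp \<equiv> sharply_transitive SL2 nonzero_vectors natural_action"

lemma sharp_det: "sharp S \<Longrightarrow> s \<in> S \<Longrightarrow> det s = 1"
  by (simp add: sharply_transitive_SL2_iff)

lemma sharp_ex1: "sharp S \<Longrightarrow> v \<noteq> 0 \<Longrightarrow> w \<noteq> 0 \<Longrightarrow> \<exists>!s. s \<in> S \<and> s *v v = w"
  by (simp add: sharply_transitive_SL2_iff)

lemma sharp_eqI: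
  assumes "sharp S" "s \<in> S" "t \<in> S" "v \<noteq> 0" "s *v v = t *v v"
  shows "s = t"
proof -
  have "s *v v \<noteq> 0" using assms SL2_nonzero[OF sharp_det] by blast
  from sharp_ex1[OF assms(1,4) this] show ?thesis using assms by auto
qed

lemma sharp_translate:
  assumes S: "sharp S" and M: "det M = 1"
  shows "sharp ((\<lambda>s. s ** M) ` S)"
  unfolding sharply_transitive_SL2_iff
proof (intro conjI ballI allI impI)
  fix s assume "s \<in> (\<lambda>s. s ** M) ` S"
  then show "det s = 1" using sharp_det[OF S] M by (auto simp: det_mul)
next
  fix v w :: "'a ^ 2" assume "v \<noteq> 0" "w \<noteq> 0"
  then have "\<exists>!s. s \<in> S \<and> s *v (M *v v) = w"
    using sharp_ex1[OF S] SL2_nonzero[OF M] by simp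
  then obtain s where s: "s \<in> S" "s *v (M *v v) = w"
    and uniq: "\<And>t. t \<in> S \<Longrightarrow> t *v (M *v v) = w \<Longrightarrow> t = s" by blast
  show "\<exists>!s. s \<in> (\<lambda>s. s ** M) ` S \<and> s *v v = w"
  proof (rule ex1I[of _ "s ** M"])
    show "s ** M \<in> (\<lambda>s. s ** M) ` S \<and> (s ** M) *v v = w"
      using s by (simp add: matrix_vector_mul_assoc)
    fix u assume "u \<in> (\<lambda>s. s ** M) ` S \<and> u *v v = w"
    then obtain t where "t \<in> S" "u = t ** M" "t *v (M *v v) = w"
      by (auto simp: matrix_vector_mul_assoc)
    then show "u = s ** M" using uniq by simp
  qed
qed

lemma inj_mult_right:
  fixes M :: "'k::field ^ 2 ^ 2"
  assumes "det M = 1"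
  shows "inj (\<lambda>s. s ** M)"
proof -
  obtain B where "M ** B = mat 1" using SL2_inverse[OF assms] by blast
  then have "(s ** M) ** B = s" for s by (simp add: matrix_mul_assoc[symmetric])
  then show ?thesis by (rule inj_on_inverseI)
qed

lemma card_vec2: "CARD('k::finite ^ 2) = CARD('k) ^ 2"
  by simp

lemma card_nonzero: "card {v :: 'k::{field,finite} ^ 2. v \<noteq> 0} = CARD('k) ^ 2 - 1"
proof -
  have "{v :: 'k ^ 2. v \<noteq> 0} = UNIV - {0}" by auto
  then show ?thesis by (simp add: card_Diff_subset card_vec2)
qed

text \<open>For each \<open>v\<close> with \<open>f v \<noteq> 0\<close>, sharp transitivity provides exactly one \<open>s\<close> that agrees with \<open>f\<close>
  at \<open>v\<close>. The function \<open>f\<close> is arbitrary; a matrix and a scalar multiplication are the two uses.\<close>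

lemma sum_card_agreements:
  fixes S :: "('k::{field,finite} ^ 2 ^ 2) set"
  assumes S: "sharp S"
  shows "(\<Sum>s\<in>S. card {v. v \<noteq> 0 \<and> s *v v = f v}) = card {v. v \<noteq> 0 \<and> f v \<noteq> 0}"
proof -
  have "(\<Sum>s\<in>S. card {v. v \<noteq> 0 \<and> s *v v = f v}) = (\<Sum>s\<in>S. \<Sum>v | v \<noteq> 0. if s *v v = f v then 1 else 0)"
    by (intro sum.cong refl) (simp add: sum.If_cases Int_def)
  also have "\<dots> = (\<Sum>v | v \<noteq> 0. \<Sum>s\<in>S. if s *v v = f v then 1 else 0)"
    by (rule sum.swap)
  also have "\<dots> = (\<Sum>v | v \<noteq> 0. if f v \<noteq> 0 then 1 else 0)"
  proof (intro sum.cong refl)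
    fix v :: "'k ^ 2" assume "v \<in> {v. v \<noteq> 0}"
    then have v: "v \<noteq> 0" by simp
    have "card {s \<in> S. s *v v = f v} = (if f v \<noteq> 0 then 1 else 0)"
    proof (cases "f v = 0")
      case True
      then have "{s \<in> S. s *v v = f v} = {}"
        using SL2_nonzero[OF sharp_det[OF S]] v by auto
      then show ?thesis using True by (metis card.empty)
    next
      case False
      then obtain s where "{s \<in> S. s *v v = f v} = {s}"
        using sharp_ex1[OF S v False] by auto
      then show ?thesis using False by simp
    qed
    then show "(\<Sum>s\<in>S. if s *v v = f v then 1 else 0) = (if f v \<noteq> 0 then 1 else 0 :: nat)"
      by (simp add: sum.If_cases Int_def)
  qed
  also have "\<dots> = card {v. v \<noteq> 0 \<and> f v \<noteq> 0}"
    by (simp add: sum.If_cases Int_def)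
  finally show ?thesis .
qed

lemma card_sharp:
  fixes S :: "('k::{field,finite} ^ 2 ^ 2) set"
  assumes S: "sharp S"
  shows "card S = CARD('k) ^ 2 - 1"
proof -
  let ?e = "axis 1 1 :: 'k ^ 2"
  have e: "?e \<noteq> 0" by (simp add: axis_eq_0_iff)
  have "bij_betw (\<lambda>s. s *v ?e) S {v. v \<noteq> 0}"
  proof (rule bij_betwI')
    show "(s *v ?e = t *v ?e) = (s = t)" if "s \<in> S" "t \<in> S" for s t
      using sharp_eqI[OF S that e] by blast
    show "s *v ?e \<in> {v. v \<noteq> 0}" if "s \<in> S" for s
      using SL2_nonzero[OF sharp_det[OF S that]] e by auto
    show "\<exists>s\<in>S. w = s *v ?e" if "w \<in> {v. v \<noteq> 0}" for w
      using sharp_ex1[OF S e] that by blast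
  qed
  then show ?thesis using bij_betw_same_card card_nonzero by metis
qed

lemma det_mat2: "det (A :: 'k::comm_ring_1 ^ 2 ^ 2) = A $ 1 $ 1 * A $ 2 $ 2 - A $ 1 $ 2 * A $ 2 $ 1"
  by (simp add: det_2)

lemma trace_mat2: "trace (A :: 'k::comm_ring_1 ^ 2 ^ 2) = A $ 1 $ 1 + A $ 2 $ 2"
  by (simp add: trace_def sum_2)

lemma mat2_eq_iff:
  "A = B \<longleftrightarrow> A $ 1 $ 1 = B $ 1 $ 1 \<and> A $ 1 $ 2 = B $ 1 $ 2 \<and> A $ 2 $ 1 = B $ 2 $ 1 \<and> A $ 2 $ 2 = B $ 2 $ 2"
  for A B :: "'k ^ 2 ^ 2"
  by (auto simp: vec_eq_iff forall_2)

lemma mat2_mult: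
  fixes A B :: "'k::semiring_1 ^ 2 ^ 2"
  shows "(A ** B) $ i $ j = A $ i $ 1 * B $ 1 $ j + A $ i $ 2 * B $ 2 $ j"
  by (simp add: matrix_matrix_mult_def sum_2)

lemma mat2_mult_vec:
  fixes A :: "'k::semiring_1 ^ 2 ^ 2"
  shows "(A *v v) $ i = A $ i $ 1 * v $ 1 + A $ i $ 2 * v $ 2"
  by (simp add: matrix_vector_mult_def sum_2)

lemma of_nat_CARD: "of_nat CARD('k) = (0 :: 'k::{field,finite})"
proof -
  have "(\<Sum>x\<in>UNIV. x :: 'k) = (\<Sum>x\<in>UNIV. x + 1)"
    by (rule sum.reindex_bij_witness[of _ "\<lambda>x. x + 1" "\<lambda>x. x - 1"]) auto
  then show ?thesis by (simp add: sum.distrib)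
qed

lemma power_CARD_minus_1:
  fixes x :: "'k::{field,finite}"
  assumes "x \<noteq> 0"
  shows "x ^ (CARD('k) - 1) = 1"
proof -
  have "(\<Prod>y\<in>UNIV - {0}. y) = (\<Prod>y\<in>UNIV - {0}. x * y)"
    by (rule prod.reindex_bij_witness[of _ "\<lambda>y. x * y" "\<lambda>y. y / x"]) (use assms in auto)
  also have "\<dots> = x ^ (CARD('k) - 1) * (\<Prod>y\<in>UNIV - {0}. y)"
    by (simp add: prod.distrib card_Diff_subset)
  finally show ?thesis by simp
qed

lemma det_nonzero_kernel:
  fixes A :: "'k::field ^ 2 ^ 2"
  assumes "det A \<noteq> 0"
  shows "A *v v = 0 \<longleftrightarrow> v = 0"
proof -
  obtain B where "B ** A = mat 1"
    using assms invertible_det_nz[of A] unfolding invertible_def by blast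
  then have "B *v (A *v v) = v" by (simp add: matrix_vector_mul_assoc)
  then show ?thesis by auto
qed

text \<open>The kernel of a singular matrix over a field with \<open>q\<close> elements has \<open>q\<close> or \<open>q\<^sup>2\<close> vectors. Modulo
  the characteristic the two cases agree once the zero vector is left out.\<close>

lemma card_kernel:
  fixes A :: "'k::{field,finite} ^ 2 ^ 2"
  shows "of_nat (card {v. v \<noteq> 0 \<and> A *v v = 0}) = (if det A = 0 then -1 else 0 :: 'k)"
proof (cases "det A = 0")
  case False
  then have "A *v v = 0 \<longleftrightarrow> v = 0" for v by (rule det_nonzero_kernel)
  then have "{v. v \<noteq> 0 \<and> A *v v = 0} = {}" by blast
  then show ?thesis using False by (simp only: card.empty) simp
next
  case True
  have split: "of_nat (card {v. v \<noteq> 0 \<and> A *v v = 0}) = (of_nat (card {v. A *v v = 0}) :: 'k) - 1"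
  proof -
    have "{v. A *v v = 0} = insert 0 {v. v \<noteq> 0 \<and> A *v v = 0}" by auto
    then have "card {v. A *v v = 0} = Suc (card {v. v \<noteq> 0 \<and> A *v v = 0})" by simp
    then show ?thesis by simp
  qed
  have "\<not> (\<forall>v. A *v v = 0 \<longrightarrow> v = 0)"
    using True invertible_det_nz[of A] matrix_left_invertible_ker[of A] invertible_left_inverse[of A]
    by auto
  then obtain v where v: "v \<noteq> 0" "A *v v = 0" by blast
  have "of_nat (card {v. A *v v = 0}) = (0 :: 'k)"
  proof (cases "A = 0")
    case True
    then have "{v. A *v v = 0} = UNIV" by simp
    then show ?thesis by (simp add: card_vec2 of_nat_CARD)
  next
    case False
    have "{w. A *v w = 0} = (\<lambda>c. c *s v) ` UNIV"
    proof (intro equalityI subsetI)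
      fix w assume "w \<in> {w. A *v w = 0}"
      then have w: "A $ i $ 1 * w $ 1 + A $ i $ 2 * w $ 2 = 0" for i
        by (auto simp: vec_eq_iff matrix_vector_mult_def sum_2)
      have v': "A $ i $ 1 * v $ 1 + A $ i $ 2 * v $ 2 = 0" for i
        using v by (auto simp: vec_eq_iff matrix_vector_mult_def sum_2)
      have "A $ i $ 1 * (v $ 1 * w $ 2 - v $ 2 * w $ 1) = 0"
           "A $ i $ 2 * (v $ 1 * w $ 2 - v $ 2 * w $ 1) = 0" for i
        proof -
        have "A $ i $ 1 * (v $ 1 * w $ 2 - v $ 2 * w $ 1) =
            w $ 2 * (A $ i $ 1 * v $ 1 + A $ i $ 2 * v $ 2)
            - v $ 2 * (A $ i $ 1 * w $ 1 + A $ i $ 2 * w $ 2)"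
          by (simp add: algebra_simps)
        then show "A $ i $ 1 * (v $ 1 * w $ 2 - v $ 2 * w $ 1) = 0" by (simp add: w v')
        have "A $ i $ 2 * (v $ 1 * w $ 2 - v $ 2 * w $ 1) =
            v $ 1 * (A $ i $ 1 * w $ 1 + A $ i $ 2 * w $ 2)
            - w $ 1 * (A $ i $ 1 * v $ 1 + A $ i $ 2 * v $ 2)"
          by (simp add: algebra_simps)
        then show "A $ i $ 2 * (v $ 1 * w $ 2 - v $ 2 * w $ 1) = 0" by (simp add: w v')
      qed
      moreover obtain i where "A $ i $ 1 \<noteq> 0 \<or> A $ i $ 2 \<noteq> 0"
        using False by (auto simp: vec_eq_iff forall_2)
      ultimately have eq: "v $ 1 * w $ 2 = v $ 2 * w $ 1" by auto
      have "v $ 1 \<noteq> 0 \<or> v $ 2 \<noteq> 0" using v by (auto simp: vec_eq_iff forall_2)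
      then show "w \<in> (\<lambda>c. c *s v) ` UNIV"
      proof
        assume "v $ 1 \<noteq> 0"
        then have "w = (w $ 1 / v $ 1) *s v"
          using eq by (auto simp: vec_eq_iff forall_2 field_simps)
        then show ?thesis by blast
      next
        assume "v $ 2 \<noteq> 0"
        then have "w = (w $ 2 / v $ 2) *s v"
          using eq by (auto simp: vec_eq_iff forall_2 field_simps)
        then show ?thesis by blast
      qed
    qed (auto simp: v vector_scalar_commute)
    moreover have "inj (\<lambda>c. c *s v)" using v by (auto simp: inj_def)
    ultimately show ?thesis by (simp add: card_image of_nat_CARD)
  qed
  then show ?thesis using split True by simp
qed

section \<open>The number of elements with given elliptic trace, modulo the characteristic\<close>

lemma CARD_field_gt_1: "CARD('k::{field,finite}) > 1"
proof -
  have "card {0, 1 :: 'k} \<le> CARD('k)" by (rule card_mono) auto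
  then show ?thesis by simp
qed

lemma of_nat_card_sharp:
  fixes S :: "('k::{field,finite} ^ 2 ^ 2) set"
  assumes "sharp S"
  shows "of_nat (card S) = (-1 :: 'k)"
proof -
  have "card S + 1 = CARD('k) ^ 2" using card_sharp[OF assms] CARD_field_gt_1[where 'k='k] by simp
  then have "of_nat (card S + 1) = (of_nat (CARD('k) ^ 2) :: 'k)" by (simp only:)
  then show ?thesis by (simp add: of_nat_CARD eq_neg_iff_add_eq_0 add.commute)
qed

lemma power_CARD_minus_1_if:
  fixes x :: "'k::{field,finite}"
  shows "x ^ (CARD('k) - 1) = (if x = 0 then 0 else 1)"
  using power_CARD_minus_1[of x] CARD_field_gt_1[where 'k='k] by simp

text \<open>The base of the summand is \<open>det (s - D)\<close> for the diagonal matrix \<open>D\<close> with entries \<open>y\<close>, \<open>z\<close>, so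
  its power is \<open>0\<close> for singular \<open>s - D\<close> and \<open>1\<close> otherwise. By \<open>card_kernel\<close> the sum is therefore a
  count of the pairs \<open>(s, v)\<close> with \<open>s v = D v\<close>.\<close>

lemma sum_det_diff_diag:
  fixes S :: "('k::{field,finite} ^ 2 ^ 2) set"
  assumes S: "sharp S"
  shows "(\<Sum>s\<in>S. (1 + y * z - s $ 1 $ 1 * z - s $ 2 $ 2 * y) ^ (CARD('k) - 1))
    = -1 - (y * z) ^ (CARD('k) - 1)"
proof -
  define D :: "'k ^ 2 ^ 2" where "D = vector [vector [y, 0], vector [0, z]]"
  have detD: "det D = y * z" by (simp add: D_def det_2)
  have det: "det (s - D) = 1 + y * z - s $ 1 $ 1 * z - s $ 2 $ 2 * y" if "s \<in> S" for s
    using sharp_det[OF S that] by (simp add: D_def det_2 algebra_simps)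
  have eq: "s *v v = D *v v \<longleftrightarrow> (s - D) *v v = 0" for s v
    by (simp add: matrix_vector_mult_diff_rdistrib)
  have "(\<Sum>s\<in>S. (1 + y * z - s $ 1 $ 1 * z - s $ 2 $ 2 * y) ^ (CARD('k) - 1))
    = (\<Sum>s\<in>S. 1 + of_nat (card {v. v \<noteq> 0 \<and> s *v v = D *v v}))"
    by (intro sum.cong refl) (simp add: power_CARD_minus_1_if[unfolded One_nat_def] eq card_kernel det)
  also have "\<dots> = of_nat (card S) + of_nat (card {v. v \<noteq> 0 \<and> D *v v \<noteq> 0})"
    by (simp add: sum.distrib sum_card_agreements[OF S] flip: of_nat_sum)
  also have "of_nat (card {v. v \<noteq> 0 \<and> D *v v \<noteq> 0}) = -1 - (if y * z = 0 then -1 else 0 :: 'k)"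
  proof -
    have "{v. v \<noteq> 0 \<and> D *v v \<noteq> 0} \<union> {v. v \<noteq> 0 \<and> D *v v = 0} = {v. v \<noteq> 0}" by auto
    then have "card {v. v \<noteq> 0 \<and> D *v v \<noteq> 0} + card {v. v \<noteq> 0 \<and> D *v v = 0} = card S"
      by (subst card_Un_disjoint[symmetric]) (auto simp: card_sharp[OF S] card_nonzero)
    then have "of_nat (card {v. v \<noteq> 0 \<and> D *v v \<noteq> 0}) + of_nat (card {v. v \<noteq> 0 \<and> D *v v = 0})
        = (of_nat (card S) :: 'k)" by (simp only: of_nat_add[symmetric])
    then show ?thesis
      by (simp only: card_kernel detD of_nat_card_sharp[OF S] eq_diff_eq)
  qed
  finally show ?thesis by (simp add: of_nat_card_sharp[OF S] power_CARD_minus_1_if[unfolded One_nat_def])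
qed

text \<open>The difference of the two sides is a polynomial of degree below \<open>q\<close> that vanishes on all
  \<open>q\<close> elements of the field.\<close>

lemma power_sum_identity_alg_closure:
  fixes \<alpha> \<beta> :: "'i \<Rightarrow> 'k::{field,finite} alg_closure"
  assumes S: "finite S" and "\<And>c :: 'k. (\<Sum>s\<in>S. (\<alpha> s + \<beta> s * to_ac c) ^ (CARD('k) - 1)) =
    \<gamma> + \<delta> * to_ac c ^ (CARD('k) - 1)"
  shows "(\<Sum>s\<in>S. (\<alpha> s + \<beta> s * l) ^ (CARD('k) - 1)) = \<gamma> + \<delta> * l ^ (CARD('k) - 1)"
proof -
  let ?m = "CARD('k) - 1"
  define p where "p = (\<Sum>s\<in>S. [:\<alpha> s, \<beta> s:] ^ ?m) - [:\<gamma>:] - monom \<delta> ?m"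
  have poly_p: "poly p l = (\<Sum>s\<in>S. (\<alpha> s + \<beta> s * l) ^ ?m) - \<gamma> - \<delta> * l ^ ?m" for l
    by (simp add: p_def poly_sum poly_monom mult.commute)
  have "degree ([:\<alpha> s, \<beta> s:] ^ ?m) \<le> ?m" for s
    by (rule order_trans[OF degree_power_le]) simp
  then have "degree p \<le> ?m"
    unfolding p_def by (intro degree_diff_le degree_sum_le degree_monom_le) (simp_all add: S)
  moreover have "card {x. poly p x = 0} \<ge> CARD('k)" if "p \<noteq> 0"
  proof -
    have "range (to_ac :: 'k \<Rightarrow> _) \<subseteq> {x. poly p x = 0}"
      using assms by (auto simp: poly_p)
    then have "card (range (to_ac :: 'k \<Rightarrow> _)) \<le> card {x. poly p x = 0}"
      using poly_roots_finite[OF that] by (rule card_mono[rotated])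
    then show ?thesis by (simp add: card_image inj_to_ac)
  qed
  ultimately have "p = 0"
    using card_poly_roots_bound[of p] CARD_field_gt_1[where 'k='k] by fastforce
  then show ?thesis using poly_p[of l] by (simp add: algebra_simps)
qed

text \<open>The variables are moved from the field to its closure one at a time, since only the degrees in the
  single variables are below \<open>q\<close>.\<close>

lemma sum_det_diff_diag_alg_closure:
  fixes S :: "('k::{field,finite} ^ 2 ^ 2) set" and l m :: "'k alg_closure"
  assumes S: "sharp S"
  shows "(\<Sum>s\<in>S. (1 + l * m - to_ac (s $ 1 $ 1) * m - to_ac (s $ 2 $ 2) * l) ^ (CARD('k) - 1))
    = -1 - (l * m) ^ (CARD('k) - 1)"
proof -
  have 1: "(\<Sum>s\<in>S. (1 + to_ac y * to_ac z - to_ac (s $ 1 $ 1) * to_ac z - to_ac (s $ 2 $ 2) * to_ac y)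
      ^ (CARD('k) - 1)) = -1 - (to_ac y * to_ac z) ^ (CARD('k) - 1)" for y z :: 'k
    using arg_cong[OF sum_det_diff_diag[OF S, of y z], of to_ac] by (simp add: to_ac_sum)
  have 2: "(\<Sum>s\<in>S. (1 + l * to_ac z - to_ac (s $ 1 $ 1) * to_ac z - to_ac (s $ 2 $ 2) * l)
      ^ (CARD('k) - 1)) = -1 - (l * to_ac z) ^ (CARD('k) - 1)" for z :: 'k
    using power_sum_identity_alg_closure[where S=S and \<alpha> = "\<lambda>s. 1 - to_ac (s $ 1 $ 1) * to_ac z"
        and \<beta> = "\<lambda>s. to_ac z - to_ac (s $ 2 $ 2)" and \<gamma> = "-1" and \<delta> = "- (to_ac z ^ (CARD('k) - 1))" and l = l]
      1[of _ z]
    by (simp add: algebra_simps power_mult_distrib)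
  show ?thesis
    using power_sum_identity_alg_closure[where S=S and \<alpha> = "\<lambda>s. 1 - to_ac (s $ 2 $ 2) * l"
        and \<beta> = "\<lambda>s. l - to_ac (s $ 1 $ 1)" and \<gamma> = "-1" and \<delta> = "- (l ^ (CARD('k) - 1))" and l = m] 2
    by (simp add: algebra_simps power_mult_distrib)
qed

text \<open>For \<open>det s = 1\<close> and \<open>trace s = x\<close> the polynomial is the characteristic polynomial of \<open>s\<close>, so that
  \<open>x\<close> is elliptic if and only if \<open>s\<close> fixes no line.\<close>

definition elliptic :: "'k::field \<Rightarrow> bool" where
  "elliptic x \<longleftrightarrow> (\<forall>w. w ^ 2 - x * w + 1 \<noteq> 0)"

lemma CARD_eq_CHAR_power:
  assumes "primepow CARD('k::{field,finite})"
  obtains n where "n > 0" "CARD('k) = CHAR('k) ^ n" "prime CHAR('k)"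
proof -
  have pr: "prime CHAR('k)" by (intro prime_CHAR_semidom finite_imp_CHAR_pos) auto
  obtain p n where p: "prime p" "n > 0" "CARD('k) = p ^ n"
    using assms by (auto simp: primepow_def)
  have "CHAR('k) dvd p ^ n"
    using of_nat_CARD[where 'k='k] unfolding of_nat_eq_0_iff_char_dvd p(3) .
  then have "CHAR('k) = p" using pr p(1) prime_dvd_power primes_dvd_imp_eq by blast
  then show thesis using that p pr by blast
qed

text \<open>The Frobenius map \<open>l \<mapsto> l\<^sup>q\<close> exchanges the two roots \<open>l\<close> and \<open>1 / l\<close>, as it fixes only the elements
  of the field itself.\<close>

lemma elliptic_root:
  fixes x :: "'k::{field,finite}"
  assumes x: "elliptic x" and q: "primepow CARD('k)"
  obtains l :: "'k alg_closure"
  where "l * l ^ CARD('k) = 1" "l + l ^ CARD('k) = to_ac x"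
proof -
  obtain l :: "'k alg_closure" where "poly [:1, - to_ac x, 1:] l = 0"
    using alg_closed_imp_poly_has_root[of "[:1, - to_ac x, 1:]"] by auto
  then have l: "l ^ 2 + 1 = to_ac x * l" by (simp add: algebra_simps power2_eq_square)
  define m where "m = l ^ CARD('k)"
  obtain n where n: "CARD('k) = CHAR('k) ^ n" "prime CHAR('k)"
    using CARD_eq_CHAR_power[OF q] by metis
  have "(l ^ 2 + 1) ^ CARD('k) = (l ^ 2) ^ CARD('k) + 1 ^ CARD('k)"
    by (rule freshmans_dream'[where n = n]) (use n in simp_all)
  moreover have "x ^ CARD('k) = x" if "x \<noteq> 0" for x :: 'k
    using power_CARD_minus_1[OF that] CARD_field_gt_1[where 'k='k]
    by (subst power_eq_if) simp
  then have pc: "x ^ CARD('k) = x" for x :: 'k using CARD_field_gt_1[where 'k='k] by (cases "x = 0") auto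
  ultimately have m: "m ^ 2 + 1 = to_ac x * m"
    unfolding l m_def by (simp add: power_mult_distrib flip: to_ac_power power_mult) 
      (simp add: mult.commute)
  have "l \<notin> range to_ac"
  proof
    assume "l \<in> range to_ac"
    then obtain w where "l = to_ac w" by blast
    then have "to_ac (w ^ 2 - x * w + 1) = 0" using l by (simp add: algebra_simps)
    then show False using x unfolding elliptic_def to_ac_eq_0_iff by blast
  qed
  have "m \<noteq> l"
  proof
    assume "m = l"
    define p :: "'k alg_closure poly" where "p = monom 1 CARD('k) - [:0, 1:]"
    have "coeff p CARD('k) = 1"
      using CARD_field_gt_1[where 'k='k] by (simp add: p_def coeff_pCons split: nat.splits)
    then have p0: "p \<noteq> 0" by auto
    have "degree p \<le> CARD('k)"
      unfolding p_def using CARD_field_gt_1[where 'k='k]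
      by (intro degree_diff_le degree_monom_le) auto
    then have "card {x. poly p x = 0} \<le> CARD('k)" using card_poly_roots_bound[OF p0] by linarith
    moreover have "insert l (range to_ac) \<subseteq> {x. poly p x = 0}"
      using \<open>m = l\<close> by (auto simp: p_def poly_monom m_def pc simp flip: to_ac_power)
    then have "card (insert l (range (to_ac :: 'k \<Rightarrow> _))) \<le> card {x. poly p x = 0}"
      using poly_roots_finite[OF p0] by (rule card_mono[rotated])
    ultimately show False using \<open>l \<notin> range to_ac\<close> by (simp add: card_image inj_to_ac)
  qed
  moreover have "(m - l) * (m + l - to_ac x) = (m ^ 2 + 1 - to_ac x * m) - (l ^ 2 + 1 - to_ac x * l)"
    by (simp add: algebra_simps power2_eq_square)
  then have "(m - l) * (m + l - to_ac x) = 0" by (simp add: l m)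
  ultimately have sum: "l + m = to_ac x" by (simp add: add.commute)
  have "l * m = 1" using l unfolding sum[symmetric] by (simp add: algebra_simps power2_eq_square)
  then show thesis using that sum unfolding m_def by blast
qed

text \<open>Setting \<open>y = z = l\<close> in \<open>sum_det_diff_diag_alg_closure\<close> turns \<open>det (s - D)\<close> into
  \<open>l (x - trace s)\<close>, so the sum counts the \<open>s\<close> with \<open>trace s \<noteq> x\<close> up to the factor \<open>l\<^sup>q\<^sup>-\<^sup>1 = 1 / l\<^sup>2\<close>.
  The right-hand side becomes \<open>- (l\<^sup>2 + l\<^sup>-\<^sup>2) / l\<^sup>2 = - (x\<^sup>2 - 2) / l\<^sup>2\<close>.\<close>

theorem elliptic_trace_count:
  fixes S :: "('k::{field,finite} ^ 2 ^ 2) set"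
  assumes S: "sharp S" and x: "elliptic x" and q: "primepow CARD('k)"
  shows "of_nat (card {s \<in> S. trace s = x}) = x ^ 2 - 3"
proof -
  let ?m = "CARD('k) - 1"
  obtain l :: "'k alg_closure"
    where lm: "l * l ^ CARD('k) = 1" and sum: "l + l ^ CARD('k) = to_ac x"
    using elliptic_root[OF x q] by metis
  have le: "l ^ CARD('k) = l * l ^ ?m"
    by (subst power_eq_if) simp
  have l2: "1 + l * l = to_ac x * l"
    using lm unfolding sum[symmetric] by (simp add: algebra_simps)
  have "(\<Sum>s\<in>S. (x - trace s) ^ ?m) = (\<Sum>s\<in>S. 1 - (if trace s = x then 1 else 0))"
    by (intro sum.cong refl) (auto simp only: power_CARD_minus_1_if diff_self right_minus_eq split: if_splits, simp_all)
  also have "\<dots> = -1 - of_nat (card {s \<in> S. trace s = x})"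
    by (simp add: sum_subtractf of_nat_card_sharp[OF S] sum.If_cases Int_def)
  finally have N: "(\<Sum>s\<in>S. (x - trace s) ^ ?m) = -1 - of_nat (card {s \<in> S. trace s = x})" .
  have "-1 - (l * l) ^ ?m = (\<Sum>s\<in>S. (1 + l * l - to_ac (s $ 1 $ 1) * l - to_ac (s $ 2 $ 2) * l) ^ ?m)"
    by (rule sum_det_diff_diag_alg_closure[OF S, symmetric])
  also have "\<dots> = (\<Sum>s\<in>S. l ^ ?m * to_ac ((x - trace s) ^ ?m))"
    by (intro sum.cong refl)
      (simp only: l2 trace_mat2 to_ac_power power_mult_distrib[symmetric], simp add: algebra_simps)
  also have "\<dots> = l ^ ?m * to_ac (\<Sum>s\<in>S. (x - trace s) ^ ?m)"
    by (simp add: sum_distrib_left to_ac_sum)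
  finally have "-1 - (l * l) ^ ?m = l ^ ?m * to_ac (\<Sum>s\<in>S. (x - trace s) ^ ?m)" .
  then have main: "-1 - l ^ ?m * l ^ ?m = l ^ ?m * (-1 - of_nat (card {s \<in> S. trace s = x}))"
    unfolding N by (simp add: power_mult_distrib)
  define e where "e = l ^ ?m"
  define n where "n = (of_nat (card {s \<in> S. trace s = x}) :: 'k alg_closure)"
  have le': "l * (l * e) = 1" and sum': "to_ac x = l + l * e"
    using lm sum unfolding le e_def by simp_all
  have "-1 - e * e = e * (-1 - n)" using main by (simp add: e_def n_def)
  then have "l * l * (-1 - e * e) = l * l * (e * (-1 - n))" by simp
  also have "\<dots> = l * (l * e) * (-1 - n)" by (simp add: algebra_simps)
  finally have "n = l * l + (l * e) * (l * e) - 1" unfolding le' by (simp add: algebra_simps)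
  also have "\<dots> = (l + l * e) ^ 2 - 2 * (l * (l * e)) - 1"
    by (simp add: power2_eq_square algebra_simps)
  also have "\<dots> = to_ac (x ^ 2 - 3)" unfolding le' by (simp add: sum')
  finally have "to_ac (of_nat (card {s \<in> S. trace s = x})) = to_ac (x ^ 2 - 3)" by (simp add: n_def)
  then show ?thesis by (simp only: to_ac_eq_iff)
qed

section \<open>Elliptic elements and the reduction to prime fields\<close>

text \<open>The elements that are not elliptic are the values of \<open>w + 1 / w\<close> at nonzero \<open>w\<close>. Each of them is
  taken at least twice, except possibly \<open>2\<close> and \<open>-2\<close>, which are taken at \<open>1\<close> and \<open>-1\<close>.\<close>

lemma card_elliptic: "CARD('k) \<le> 2 * card {x :: 'k::{field,finite}. elliptic x} + 1"
proof -
  let ?B = "{x :: 'k. \<not> elliptic x}"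
  define A where "A x = {w :: 'k. w ^ 2 - x * w + 1 = 0}" for x
  have ge: "2 \<le> card (A x) + (if x \<in> {2, -2} then 1 else 0)" if x: "x \<in> ?B" for x
  proof -
    obtain w where w: "w ^ 2 - x * w + 1 = 0" using x by (auto simp: elliptic_def)
    have "(x - w) ^ 2 - x * (x - w) + 1 = w ^ 2 - x * w + 1" by (simp add: algebra_simps power2_eq_square)
    then have w': "(x - w) ^ 2 - x * (x - w) + 1 = 0" using w by simp
    have sub: "{w, x - w} \<subseteq> A x" using w w' by (simp add: A_def)
    show ?thesis
    proof (cases "w = x - w")
      case True
      then have "x = 2 * w" by (metis add_diff_cancel_left' diff_eq_eq mult_2)
      with w have "w ^ 2 = 1" by (simp add: algebra_simps power2_eq_square)
      then have "w = 1 \<or> w = -1" by (simp add: power2_eq_1_iff)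
      then have "x \<in> {2, -2}" using \<open>x = 2 * w\<close> by auto
      moreover have "card {w} \<le> card (A x)" using sub by (intro card_mono) auto
      ultimately show ?thesis by simp
    next
      case False
      moreover have "card {w, x - w} \<le> card (A x)" using sub by (intro card_mono) auto
      ultimately show ?thesis by simp
    qed
  qed
  have "card ?B * 2 = (\<Sum>x\<in>?B. 2)" by simp
  also have "\<dots> \<le> (\<Sum>x\<in>?B. card (A x) + (if x \<in> {2, -2} then 1 else 0))"
    by (rule sum_mono) (rule ge)
  also have "\<dots> = card (\<Union>x\<in>?B. A x) + card (?B \<inter> {2, -2})"
  proof -
    have "A x \<inter> A y = {}" if "x \<noteq> y" for x y
    proof (rule ccontr)
      assume "A x \<inter> A y \<noteq> {}"
      then obtain w where "w ^ 2 - x * w + 1 = 0" "w ^ 2 - y * w + 1 = 0" by (auto simp: A_def)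
      moreover have "(x - y) * w = (w ^ 2 - y * w + 1) - (w ^ 2 - x * w + 1)"
        by (simp add: algebra_simps)
      ultimately have "(x - y) * w = 0" "w \<noteq> 0" by auto
      then show False using that by simp
    qed
    then have "card (\<Union>x\<in>?B. A x) = (\<Sum>x\<in>?B. card (A x))"
      by (intro card_UN_disjoint) auto
    then show ?thesis by (simp add: sum.distrib sum.If_cases Int_def)
  qed
  also have "card (\<Union>x\<in>?B. A x) \<le> card (UNIV - {0 :: 'k})"
    by (rule card_mono) (auto simp: A_def)
  also have "card (?B \<inter> {2, -2}) \<le> card {2, -2 :: 'k}"
    by (rule card_mono) auto
  also have "card {2, -2 :: 'k} \<le> 2" by (simp add: card_insert_if)
  finally have "card ?B * 2 \<le> CARD('k) - 1 + 2" by (simp add: card_Diff_subset)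
  moreover have "card ?B + card {x :: 'k. elliptic x} = CARD('k)"
    by (subst card_Un_disjoint[symmetric]) (auto intro!: arg_cong[where f = card])
  ultimately show ?thesis using CARD_field_gt_1[where 'k='k] by linarith
qed

lemma card_square_roots: "card {x :: 'k::{field,finite}. x ^ 2 = u} \<le> 2"
proof (cases "\<exists>x :: 'k. x ^ 2 = u")
  case True
  then obtain x where "x ^ 2 = u" by blast
  then have "{x. x ^ 2 = u} \<subseteq> {x, - x}" by (auto simp: power2_eq_iff)
  then have "card {x. x ^ 2 = u} \<le> card {x, - x}" by (rule card_mono[rotated]) simp
  also have "\<dots> \<le> 2" by (simp add: card_insert_if)
  finally show ?thesis .
qed simp

lemma elliptic_square_ne_4:
  assumes "elliptic (x :: 'k::field)"
  shows "x ^ 2 \<noteq> 4"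
proof
  assume "x ^ 2 = 4"
  then have "(x - 2) * (x + 2) = 0" by (simp add: algebra_simps power2_eq_square)
  then have "x = 2 \<or> x = -2" by (simp add: eq_neg_iff_add_eq_0)
  then show False
    using assms[unfolded elliptic_def, rule_format, of 1] assms[unfolded elliptic_def, rule_format, of "-1"]
    by auto
qed

text \<open>Squares of elliptic elements lie in the prime field \<open>F\<close> with \<open>p\<close> elements by
  \<open>elliptic_trace_count\<close>, so there are at most \<open>2 (p - 2) + 1\<close> elliptic elements if \<open>p\<close> is odd and at
  most one if \<open>p = 2\<close>. Both are fewer than \<open>(p\<^sup>2 - 1) / 2\<close>.\<close>

lemma sharp_imp_prime_CARD:
  fixes S :: "('k::{field,finite} ^ 2 ^ 2) set"
  assumes S: "sharp S" and q: "primepow CARD('k)"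
  shows "prime CARD('k)"
proof -
  obtain n where n: "n > 0" "CARD('k) = CHAR('k) ^ n" "prime CHAR('k)"
    using CARD_eq_CHAR_power[OF q] by metis
  let ?p = "CHAR('k)" and ?E = "{x :: 'k. elliptic x}"
  define F where "F = (of_nat ` {..<CHAR('k)} :: 'k set)"
  have of_nat_F: "of_nat m \<in> F" for m
  proof -
    have "(of_nat (?p * (m div ?p) + m mod ?p) :: 'k) = of_nat (m mod ?p)"
      by (simp only: of_nat_add of_nat_mult of_nat_CHAR mult_zero_left add_0)
    then have "(of_nat m :: 'k) = of_nat (m mod ?p)" by simp
    then show ?thesis unfolding F_def using n(3) by (auto simp: prime_gt_0_nat)
  qed
  have F: "finite F" "card F \<le> ?p" unfolding F_def using card_image_le[of "{..<?p}"] by auto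
  have sq: "x ^ 2 \<in> F" if "elliptic x" for x
  proof -
    have "x ^ 2 = of_nat (card {s \<in> S. trace s = x} + 3)"
      using elliptic_trace_count[OF S that q] by simp
    then show ?thesis by (simp only: of_nat_F)
  qed
  have "n = 1"
  proof (rule ccontr)
    assume "n \<noteq> 1"
    then have "2 \<le> n" using n(1) by linarith
    moreover have "1 \<le> ?p" using prime_ge_1_nat[OF n(3)] .
    ultimately have "?p ^ 2 \<le> CARD('k)" unfolding n(2) by (rule power_increasing)
    then have E: "?p ^ 2 \<le> 2 * card ?E + 1" using card_elliptic[where 'k='k] by linarith
    show False
    proof (cases "?p = 2")
      case True
      then have two: "(2 :: 'k) = 0" using of_nat_CHAR[where 'a='k] by simp
      have "?E \<subseteq> {1}"
      proof
        fix x :: 'k assume "x \<in> ?E"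
        then have "x ^ 2 \<in> F" "x ^ 2 \<noteq> 4" using sq elliptic_square_ne_4 by auto
        moreover have "(4 :: 'k) = 2 * 2" by simp
        then have "(4 :: 'k) = 0" by (simp only: two mult_zero_left)
        moreover have "F = {0, 1}" unfolding F_def True by (auto simp: lessThan_nat_numeral lessThan_Suc)
        ultimately have "x ^ 2 = 1" by auto
        moreover have "(x - 1) ^ 2 = (x ^ 2 - 1) + 2 * (1 - x)"
          by (simp add: algebra_simps power2_eq_square)
        ultimately have "(x - 1) ^ 2 = 0" using two by simp
        then show "x \<in> {1}" by simp
      qed
      then have "card ?E \<le> 1" using card_mono[of "{1}" ?E] by simp
      then show False using E True by simp
    next
      case False
      have "?p \<ge> 3" using False prime_ge_2_nat[OF n(3)] by simp
      have "(0 :: 'k) \<noteq> 4"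
      proof
        assume "(0 :: 'k) = 4"
        then have "of_nat 4 = (0 :: 'k)" by simp
        then have "?p dvd 2 ^ 2" unfolding of_nat_eq_0_iff_char_dvd by simp
        then have "?p dvd 2" using n(3) prime_dvd_power by blast
        then show False using \<open>?p \<ge> 3\<close> by (auto dest: dvd_imp_le)
      qed
      moreover have "0 \<in> F" "4 \<in> F" using of_nat_F[of 0] of_nat_F[of 4] by simp_all
      ultimately have cF: "card (F - {0, 4}) \<le> ?p - 2"
        using F by (simp add: card_Diff_subset)
      have "?E \<subseteq> insert 0 (\<Union>u\<in>F - {0, 4}. {x. x ^ 2 = u})"
        using sq elliptic_square_ne_4[where 'k='k] by auto
      then have "card ?E \<le> card (insert 0 (\<Union>u\<in>F - {0, 4}. {x :: 'k. x ^ 2 = u}))"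
        by (rule card_mono[rotated]) simp
      also have "\<dots> \<le> 1 + card (\<Union>u\<in>F - {0, 4}. {x :: 'k. x ^ 2 = u})"
        by (simp add: card_insert_if)
      also have "card (\<Union>u\<in>F - {0, 4}. {x :: 'k. x ^ 2 = u}) \<le> (\<Sum>u\<in>F - {0, 4}. card {x :: 'k. x ^ 2 = u})"
        by (rule card_UN_le) (simp add: F)
      also have "\<dots> \<le> (\<Sum>u\<in>F - {0, 4}. 2)" by (rule sum_mono) (rule card_square_roots)
      also have "\<dots> \<le> 2 * (?p - 2)" using cF by simp
      finally have "card ?E \<le> 1 + 2 * (?p - 2)" by simp
      then have "?p ^ 2 + 5 \<le> 4 * ?p" using E \<open>?p \<ge> 3\<close> by simp
      moreover have "?p ^ 2 + 4 \<ge> 4 * ?p"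
      proof -
        have "(int ?p - 2) ^ 2 \<ge> 0" by simp
        then have "int (4 * ?p) \<le> int (?p ^ 2 + 4)" by (simp add: power2_eq_square algebra_simps)
        then show ?thesis by (simp only: of_nat_le_iff)
      qed
      ultimately show False by simp
    qed
  qed
  then show ?thesis using n by simp
qed

section \<open>Pairs of trace conditions and points on a conic\<close>

text \<open>Project the conic from one of its points \<open>(m0, n0)\<close>: each of the other points has its own
  slope among \<open>q + 1\<close>. The slope of the tangent at \<open>(m0, n0)\<close> is not taken, and neither is that of an
  asymptote, whose slopes are given by the roots of \<open>a\<^sup>2 - y a + 1\<close>; an asymptotic direction that
  is tangent would produce a root of \<open>w\<^sup>2 - x w + 1\<close>.\<close>

lemma conic_bound:
  fixes x y :: "'k::{field,finite}"
  assumes x: "elliptic x" and y: "y \<noteq> 2"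
  shows "card {(m, n). m ^ 2 + y * m * n + n ^ 2 - x * (m + n) + 1 = 0} + card {a. a ^ 2 - y * a + 1 = 0}
    \<le> CARD('k) + 1"
proof (cases "{(m, n). m ^ 2 + y * m * n + n ^ 2 - x * (m + n) + 1 = 0} = {}")
  case True
  have "card {a. a ^ 2 - y * a + 1 = 0} \<le> CARD('k)" by (rule card_mono) auto
  then show ?thesis unfolding True by simp
next
  case False
  let ?C = "{(m, n). m ^ 2 + y * m * n + n ^ 2 - x * (m + n) + 1 = 0}"
  let ?W = "{a. a ^ 2 - y * a + 1 = 0}"
  obtain m0 n0 where P0: "m0 ^ 2 + y * m0 * n0 + n0 ^ 2 - x * (m0 + n0) + 1 = 0" using False by auto
  define \<alpha> where "\<alpha> = 2 * m0 + y * n0 - x"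
  define \<beta> where "\<beta> = 2 * n0 + y * m0 - x"
  \<comment> \<open>\<open>\<alpha>\<close> and \<open>\<beta>\<close> are the partial derivatives of the quadratic polynomial at the base point, hence
    \<open>\<alpha> - \<beta> a\<close> is its derivative in the direction \<open>(1, - a)\<close>.\<close>
  have asym: "\<alpha> - \<beta> * a \<noteq> 0" if a: "a ^ 2 - y * a + 1 = 0" for a
  proof
    assume *: "\<alpha> - \<beta> * a = 0"
    have a0: "a \<noteq> 0" using a by auto
    define b where "b = 1 / a"
    have ab: "a * b = 1" using a0 by (simp add: b_def)
    have "a * y = a * (a + b)" using a ab by (simp add: algebra_simps power2_eq_square)
    then have yab: "y = a + b" using a0 by simp
    have "a \<noteq> 1" using yab y ab by auto
    define e where "e = m0 + n0 * b"
    have "(1 - a) * ((1 + a) * e - x) = (\<alpha> - \<beta> * a) + (a * b - 1) * (m0 - a * n0)"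
      unfolding e_def \<alpha>_def \<beta>_def yab by (simp add: algebra_simps)
    then have "(1 - a) * ((1 + a) * e - x) = 0" using * ab by simp
    then have xe: "x = (1 + a) * e" using \<open>a \<noteq> 1\<close> by simp
    have "1 - a * e ^ 2 = (m0 ^ 2 + y * m0 * n0 + n0 ^ 2 - x * (m0 + n0) + 1)
        - (a * b - 1) * (e * n0 - n0 ^ 2)"
      unfolding xe unfolding e_def yab by (simp add: algebra_simps power2_eq_square)
    then have "1 - a * e ^ 2 = 0" using P0 ab by simp
    then have "e ^ 2 - x * e + 1 = 0" unfolding xe by (simp add: algebra_simps power2_eq_square)
    then show False using x unfolding elliptic_def by blast
  qed
  \<comment> \<open>The negated slope is used, to match the roots of \<open>a\<^sup>2 - y a + 1\<close>; \<open>None\<close> is the vertical direction.\<close>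
  define f where "f = (\<lambda>(m, n). if m = m0 then None else Some (- (n - n0) / (m - m0)))"
  define \<tau> where "\<tau> = (if \<beta> = 0 then None else Some (\<alpha> / \<beta>))"
  have tau: "\<tau> \<notin> Some ` ?W" using asym[of "\<alpha> / \<beta>"] by (auto simp: \<tau>_def)
  have key: "m = m0 \<and> n = n0 - \<beta> \<and> f (m, n) = None \<and> \<beta> \<noteq> 0 \<or>
      (\<exists>a d. f (m, n) = Some a \<and> d \<noteq> 0 \<and> m = m0 + d \<and> n = n0 - d * a \<and>
         d * (a ^ 2 - y * a + 1) + (\<alpha> - \<beta> * a) = 0)"
    if "(m, n) \<in> ?C - {(m0, n0)}" for m n
  proof (cases "m = m0")
    case True
    define d where "d = n - n0"
    have n: "n = n0 + d" by (simp add: d_def)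
    have "d \<noteq> 0" using that True by (auto simp: d_def)
    have "m0 ^ 2 + y * m0 * n + n ^ 2 - x * (m0 + n) + 1 = 0" using that True by simp
    moreover have "d * (d + \<beta>) = (m0 ^ 2 + y * m0 * n + n ^ 2 - x * (m0 + n) + 1)
        - (m0 ^ 2 + y * m0 * n0 + n0 ^ 2 - x * (m0 + n0) + 1)"
      unfolding n \<beta>_def by (simp add: algebra_simps power2_eq_square)
    ultimately have "d * (d + \<beta>) = 0" using P0 by simp
    then have "d = - \<beta>" using \<open>d \<noteq> 0\<close> by (simp add: eq_neg_iff_add_eq_0)
    then show ?thesis using True n \<open>d \<noteq> 0\<close> by (simp add: f_def)
  next
    case False
    define d where "d = m - m0"
    define a where "a = - (n - n0) / d"
    have d: "d \<noteq> 0" "m = m0 + d" using False by (simp_all add: d_def)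
    have n: "n = n0 - d * a" using d by (simp add: a_def)
    have "m ^ 2 + y * m * n + n ^ 2 - x * (m + n) + 1 = 0" using that by simp
    moreover have "d * (d * (a ^ 2 - y * a + 1) + (\<alpha> - \<beta> * a)) =
        (m ^ 2 + y * m * n + n ^ 2 - x * (m + n) + 1)
        - (m0 ^ 2 + y * m0 * n0 + n0 ^ 2 - x * (m0 + n0) + 1)"
      unfolding n d(2) \<alpha>_def \<beta>_def by (simp add: algebra_simps power2_eq_square)
    ultimately have "d * (d * (a ^ 2 - y * a + 1) + (\<alpha> - \<beta> * a)) = 0" using P0 by simp
    then have "d * (a ^ 2 - y * a + 1) + (\<alpha> - \<beta> * a) = 0" using d by simp
    moreover have "f (m, n) = Some a" using False by (simp add: f_def a_def d_def)
    ultimately show ?thesis using d n by blast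
  qed
  have "inj_on f (?C - {(m0, n0)})"
  proof (rule inj_onI)
    fix P P' assume P: "P \<in> ?C - {(m0, n0)}" "P' \<in> ?C - {(m0, n0)}" and eq': "f P = f P'"
    obtain m n m' n' where mn: "P = (m, n)" "P' = (m', n')" by (cases P, cases P')
    note C = P[unfolded mn] and eq = eq'[unfolded mn]
    have "m = m' \<and> n = n'"
    proof (cases "f (m, n)")
      case None
      then show ?thesis using key[OF C(1)] key[OF C(2)] eq by auto
    next
      case (Some a)
      obtain d where d: "m = m0 + d" "n = n0 - d * a" "d * (a ^ 2 - y * a + 1) + (\<alpha> - \<beta> * a) = 0"
        using key[OF C(1)] Some by auto
      obtain d' where d': "m' = m0 + d'" "n' = n0 - d' * a" "d' * (a ^ 2 - y * a + 1) + (\<alpha> - \<beta> * a) = 0"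
        using key[OF C(2)] Some eq by auto
      have "a ^ 2 - y * a + 1 \<noteq> 0" using asym[of a] d(3) by auto
      moreover have "(d - d') * (a ^ 2 - y * a + 1) = (d * (a ^ 2 - y * a + 1) + (\<alpha> - \<beta> * a))
          - (d' * (a ^ 2 - y * a + 1) + (\<alpha> - \<beta> * a))"
        by (simp add: algebra_simps)
      then have "(d - d') * (a ^ 2 - y * a + 1) = 0" using d(3) d'(3) by simp
      ultimately have "d = d'" by simp
      then show ?thesis using d d' by simp
    qed
    then show "P = P'" using mn by simp
  qed
  then have "card (?C - {(m0, n0)}) = card (f ` (?C - {(m0, n0)}))" by (simp add: card_image)
  also have "\<dots> \<le> card (UNIV - insert \<tau> (Some ` ?W))"
  proof (rule card_mono)
    have avoid: "f (m, n) \<noteq> \<tau> \<and> f (m, n) \<notin> Some ` ?W" if C: "(m, n) \<in> ?C - {(m0, n0)}" for m n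
    proof (cases "f (m, n)")
      case None
      then show ?thesis using key[OF C] by (auto simp: \<tau>_def)
    next
      case (Some a)
      then obtain d where d: "d \<noteq> 0" "d * (a ^ 2 - y * a + 1) + (\<alpha> - \<beta> * a) = 0"
        using key[OF C] by auto
      have W: "a ^ 2 - y * a + 1 \<noteq> 0" using asym[of a] d(2) by auto
      moreover have "\<tau> \<noteq> Some a"
      proof
        assume "\<tau> = Some a"
        then have "\<alpha> - \<beta> * a = 0" by (auto simp: \<tau>_def split: if_splits)
        then show False using d W by simp
      qed
      ultimately show ?thesis using Some by auto
    qed
    have "f P \<notin> insert \<tau> (Some ` ?W)" if P: "P \<in> ?C - {(m0, n0)}" for P
    proof -
      obtain m n where mn: "P = (m, n)" by (cases P)
      from avoid[OF P[unfolded mn]] show ?thesis unfolding mn by simp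
    qed
    then show "f ` (?C - {(m0, n0)}) \<subseteq> UNIV - insert \<tau> (Some ` ?W)"
      by (intro image_subsetI DiffI UNIV_I)
  qed simp
  also have "\<dots> = CARD('k option) - (1 + card ?W)"
    using tau by (subst card_Diff_subset) (simp_all add: card_image)
  also have "CARD('k option) = CARD('k) + 1" by (simp add: card_UNIV_option)
  finally have "card (?C - {(m0, n0)}) \<le> CARD('k) - card ?W" by simp
  moreover have "card ?W \<le> CARD('k)" by (rule card_mono) auto
  moreover have "card ?C = card (?C - {(m0, n0)}) + 1"
    using P0 card_Suc_Diff1[of ?C "(m0, n0)"] by simp
  ultimately show ?thesis by linarith
qed

definition trace_pairs :: "'k::{field,finite} \<Rightarrow> 'k ^ 2 ^ 2 \<Rightarrow> nat" where
  "trace_pairs x s = card {M. det M = 1 \<and> trace M = x \<and> trace (s ** M) = x}"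

definition eigenpairs :: "'k::{field,finite} ^ 2 ^ 2 \<Rightarrow> nat" where
  "eigenpairs s = card {(a, v). v \<noteq> 0 \<and> s *v v = a *s v}"

lemma trace_pairs_conj_le:
  fixes P Q s K :: "'k::{field,finite} ^ 2 ^ 2"
  assumes PQ: "P ** Q = mat 1" and s: "s ** P = P ** K"
  shows "trace_pairs x s \<le> trace_pairs x K"
proof -
  have QP: "Q ** P = mat 1" using PQ matrix_left_right_inverse by blast
  have K: "K = Q ** s ** P"
    by (simp add: matrix_mul_assoc[symmetric] s) (simp add: matrix_mul_assoc QP)
  have conj: "trace (Q ** M ** P) = trace M" for M
    by (subst trace_mul_sym) (simp add: matrix_mul_assoc PQ)
  have "K ** (Q ** M ** P) = Q ** s ** (P ** Q) ** M ** P" for M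
    by (simp only: K matrix_mul_assoc)
  then have KM: "K ** (Q ** M ** P) = Q ** (s ** M) ** P" for M
    by (simp add: PQ matrix_mul_assoc)
  have "det P * det Q = 1" using arg_cong[OF PQ, of det] by (simp add: det_mul det_I)
  moreover have "det (Q ** M ** P) = (det P * det Q) * det M" for M
    by (simp add: det_mul algebra_simps)
  ultimately have det: "det (Q ** M ** P) = det M" for M by simp
  have "P ** (Q ** M ** P) ** Q = (P ** Q) ** M ** (P ** Q)" for M
    by (simp only: matrix_mul_assoc)
  then have inj: "inj (\<lambda>M. Q ** M ** P)"
    by (intro inj_on_inverseI[where g = "\<lambda>M. P ** M ** Q"]) (simp add: PQ)
  show ?thesis
    unfolding trace_pairs_def
    by (rule card_inj_on_le[of "\<lambda>M. Q ** M ** P"])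
      (auto simp: conj det KM intro: inj_on_subset[OF inj])
qed

lemma eigenpairs_conj_le:
  fixes P Q s K :: "'k::{field,finite} ^ 2 ^ 2"
  assumes PQ: "P ** Q = mat 1" and s: "s ** P = P ** K"
  shows "eigenpairs s \<le> eigenpairs K"
proof -
  have QP: "Q ** P = mat 1" using PQ matrix_left_right_inverse by blast
  have K: "K = Q ** s ** P"
    by (simp add: matrix_mul_assoc[symmetric] s) (simp add: matrix_mul_assoc QP)
  have inv: "P *v (Q *v v) = v" for v by (simp add: matrix_vector_mul_assoc PQ)
  then have Qv: "Q *v v = 0 \<longleftrightarrow> v = 0" for v by (metis matrix_vector_mult_0_right)
  have KQ: "K *v (Q *v v) = Q *v (s *v v)" for v
    by (simp add: K inv flip: matrix_vector_mul_assoc)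
  have "inj (\<lambda>(a, v). (a, Q *v v))"
    by (rule inj_on_inverseI[where g = "\<lambda>(a, v). (a, P *v v)"]) (auto simp: inv)
  then show ?thesis
    unfolding eigenpairs_def
    by (intro card_inj_on_le[of "\<lambda>(a, v). (a, Q *v v)"])
      (auto simp: Qv KQ vector_scalar_commute intro: inj_on_subset)
qed

definition companion :: "'k::field \<Rightarrow> 'k ^ 2 ^ 2" where
  "companion y = vector [vector [0, -1], vector [1, y]]"

lemma companion_conj:
  fixes s :: "'k::field ^ 2 ^ 2"
  assumes det: "det s = 1" and ns: "\<nexists>a. s = mat a"
  obtains P Q where "P ** Q = mat 1" "s ** P = P ** companion (trace s)"
proof -
  have CH: "s $ 1 $ 1 * s $ 2 $ 2 = 1 + s $ 1 $ 2 * s $ 2 $ 1"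
    using det by (simp add: det_mat2 algebra_simps)
  define P where "P v = (vector [vector [v $ 1, (s *v v) $ 1], vector [v $ 2, (s *v v) $ 2]] :: 'k ^ 2 ^ 2)"
    for v :: "'k ^ 2"
  have sP: "s ** P v = P v ** companion (trace s)" for v
  proof -
    let ?d = "s $ 1 $ 1 * s $ 2 $ 2 - (1 + s $ 1 $ 2 * s $ 2 $ 1)"
    have "(s ** P v) $ 1 $ 2 = (P v ** companion (trace s)) $ 1 $ 2 - v $ 1 * ?d"
      "(s ** P v) $ 2 $ 2 = (P v ** companion (trace s)) $ 2 $ 2 - v $ 2 * ?d"
      by (simp_all add: P_def mat2_mult companion_def mat2_mult_vec trace_mat2 algebra_simps)
    moreover have "(s ** P v) $ 1 $ 1 = (P v ** companion (trace s)) $ 1 $ 1"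
      "(s ** P v) $ 2 $ 1 = (P v ** companion (trace s)) $ 2 $ 1"
      by (simp_all add: P_def mat2_mult companion_def mat2_mult_vec)
    ultimately show ?thesis by (simp add: mat2_eq_iff CH)
  qed
  have detP: "det (P v) = s $ 2 $ 1 * v $ 1 ^ 2 + (s $ 2 $ 2 - s $ 1 $ 1) * v $ 1 * v $ 2 - s $ 1 $ 2 * v $ 2 ^ 2" for v
    by (simp add: P_def det_mat2 mat2_mult_vec algebra_simps power2_eq_square)
  have "\<exists>v. det (P v) \<noteq> 0"
  proof (rule ccontr)
    assume "\<not> ?thesis"
    then have 0: "det (P v) = 0" for v by blast
    have "s $ 2 $ 1 = 0" using 0[of "vector [1, 0]"] by (simp add: detP)
    moreover have "s $ 1 $ 2 = 0" using 0[of "vector [0, 1]"] by (simp add: detP)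
    moreover have "s $ 2 $ 2 = s $ 1 $ 1"
      using 0[of "vector [1, 1]"] calculation by (simp add: detP)
    ultimately have "s = mat (s $ 1 $ 1)" by (simp add: mat2_eq_iff mat_def)
    then show False using ns by blast
  qed
  then obtain v where "det (P v) \<noteq> 0" by blast
  then obtain Q where "P v ** Q = mat 1" by (auto simp: invertible_det_nz[symmetric] invertible_def)
  then show thesis using that sP by blast
qed

lemma trace_pairs_companion:
  fixes x y :: "'k::{field,finite}"
  shows "trace_pairs x (companion y) \<le> card {(m, n). m ^ 2 + y * m * n + n ^ 2 - x * (m + n) + 1 = 0}"
  unfolding trace_pairs_def
proof (rule card_inj_on_le)
  let ?A = "{M. det M = 1 \<and> trace M = x \<and> trace (companion y ** M) = x}"
  let ?f = "\<lambda>M :: 'k ^ 2 ^ 2. (M $ 2 $ 2, M $ 1 $ 2)"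
  have M: "M $ 1 $ 1 = x - M $ 2 $ 2" "M $ 2 $ 1 = M $ 1 $ 2 + y * M $ 2 $ 2 - x" "det M = 1"
    if "M \<in> ?A" for M
    using that by (auto simp: trace_mat2 mat2_mult companion_def algebra_simps)
  show "inj_on ?f ?A"
    by (rule inj_onI) (auto simp only: mat2_eq_iff M prod.inject)
  show "?f ` ?A \<subseteq> {(m, n). m ^ 2 + y * m * n + n ^ 2 - x * (m + n) + 1 = 0}"
  proof (rule image_subsetI)
    fix M assume A: "M \<in> ?A"
    have "(M $ 2 $ 2) ^ 2 + y * M $ 2 $ 2 * M $ 1 $ 2 + (M $ 1 $ 2) ^ 2
        - x * (M $ 2 $ 2 + M $ 1 $ 2) + 1 = 1 - det M"
      unfolding det_mat2 M(1,2)[OF A] by (simp add: algebra_simps power2_eq_square)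
    then show "?f M \<in> {(m, n). m ^ 2 + y * m * n + n ^ 2 - x * (m + n) + 1 = 0}"
      using M(3)[OF A] by simp
  qed
qed simp

lemma eigenpairs_companion:
  fixes y :: "'k::{field,finite}"
  shows "eigenpairs (companion y) \<le> card {a. a ^ 2 - y * a + 1 = 0} * (CARD('k) - 1)"
proof -
  let ?A = "{(a, v). v \<noteq> 0 \<and> companion y *v v = a *s v}"
  let ?f = "\<lambda>(a, v :: 'k ^ 2). (a, v $ 1)"
  have v: "v $ 2 = - a * v $ 1" "a ^ 2 - y * a + 1 = 0" "v $ 1 \<noteq> 0" if "(a, v) \<in> ?A" for a v
  proof -
    have eq: "companion y *v v = a *s v" "v \<noteq> 0" using that by auto
    from eq(1) have 1: "- v $ 2 = a * v $ 1" and 2: "v $ 1 + y * v $ 2 = a * v $ 2"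
      by (simp_all add: vec_eq_iff forall_2 mat2_mult_vec companion_def)
    show v2: "v $ 2 = - a * v $ 1" using arg_cong[OF 1, of uminus] by simp
    then show v1: "v $ 1 \<noteq> 0" using eq(2) by (auto simp: vec_eq_iff forall_2)
    have "v $ 1 * (a ^ 2 - y * a + 1) = 0" using 2 unfolding v2 by (simp add: algebra_simps power2_eq_square)
    then show "a ^ 2 - y * a + 1 = 0" using v1 by simp
  qed
  have "card ?A \<le> card ({a. a ^ 2 - y * a + 1 = 0} \<times> (UNIV - {0 :: 'k}))"
  proof (rule card_inj_on_le[of ?f])
    show "inj_on ?f ?A"
    proof (rule inj_onI)
      fix p p' assume p: "p \<in> ?A" "p' \<in> ?A" and eq: "?f p = ?f p'"
      obtain a v a' v' where pp: "p = (a, v)" "p' = (a', v')" by (cases p, cases p')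
      show "p = p'"
        using v(1)[OF p(1)[unfolded pp]] v(1)[OF p(2)[unfolded pp]] eq pp
        by (simp add: vec_eq_iff forall_2)
    qed
    show "?f ` ?A \<subseteq> {a. a ^ 2 - y * a + 1 = 0} \<times> (UNIV - {0})"
      using v(2,3) by auto
  qed simp
  then show ?thesis by (simp add: eigenpairs_def card_cartesian_product card_Diff_subset)
qed

text \<open>In a basis \<open>v\<close>, \<open>s v\<close> the matrix \<open>s\<close> becomes the companion matrix of its characteristic polynomial.
  For that matrix, \<open>trace_pairs\<close> counts the points of the conic in \<open>conic_bound\<close>, and every root
  \<open>a\<close> of the characteristic polynomial belongs to a single eigenline with \<open>q - 1\<close> nonzero vectors.\<close>

lemma trace_pairs_eigenpairs_nonscalar:
  fixes s :: "'k::{field,finite} ^ 2 ^ 2"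
  assumes x: "elliptic x" and s: "det s = 1" "\<nexists>a. s = mat a" "trace s \<noteq> 2"
  shows "(CARD('k) - 1) * trace_pairs x s + eigenpairs s \<le> CARD('k) ^ 2 - 1"
proof -
  obtain P Q where PQ: "P ** Q = mat 1" "s ** P = P ** companion (trace s)"
    using companion_conj[OF s(1,2)] by metis
  let ?c = "card {(m, n). m ^ 2 + trace s * m * n + n ^ 2 - x * (m + n) + 1 = 0}"
  let ?w = "card {a. a ^ 2 - trace s * a + 1 = 0}"
  have "trace_pairs x s \<le> ?c"
    using trace_pairs_conj_le[OF PQ] trace_pairs_companion order_trans by blast
  moreover have "eigenpairs s \<le> ?w * (CARD('k) - 1)"
    using eigenpairs_conj_le[OF PQ] eigenpairs_companion order_trans by blast
  ultimately have "(CARD('k) - 1) * trace_pairs x s + eigenpairs s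
      \<le> (CARD('k) - 1) * ?c + ?w * (CARD('k) - 1)"
    by (intro add_mono mult_left_mono) simp_all
  also have "\<dots> = (CARD('k) - 1) * (?c + ?w)"
    by (simp only: distrib_left mult.commute)
  also have "\<dots> \<le> (CARD('k) - 1) * (CARD('k) + 1)"
    by (intro mult_left_mono conic_bound x s) simp
  also have "\<dots> = CARD('k) ^ 2 - 1"
    by (simp add: power2_eq_square diff_mult_distrib)
  finally show ?thesis .
qed

lemma eigenpairs_le:
  fixes s :: "'k::{field,finite} ^ 2 ^ 2"
  shows "eigenpairs s \<le> CARD('k) ^ 2 - 1"
proof -
  have "inj_on snd {(a, v). v \<noteq> 0 \<and> s *v v = a *s v}"
    by (auto simp: inj_on_def vector_mul_rcancel)
  then have "eigenpairs s \<le> card {v :: 'k ^ 2. v \<noteq> 0}"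
    unfolding eigenpairs_def by (rule card_inj_on_le) auto
  then show ?thesis by (simp add: card_nonzero)
qed

text \<open>The matrix \<open>-1\<close> satisfies the bound for a different reason: all vectors are eigenvectors, and
  \<open>trace M\<close> and \<open>trace (- M)\<close> cannot both be \<open>x\<close>.\<close>

lemma trace_pairs_eigenpairs:
  fixes s :: "'k::{field,finite} ^ 2 ^ 2"
  assumes x: "elliptic x" "2 * x \<noteq> 0" and s: "det s = 1" "s \<noteq> mat 1" "trace s \<noteq> 2"
  shows "(CARD('k) - 1) * trace_pairs x s + eigenpairs s \<le> CARD('k) ^ 2 - 1"
proof (cases "\<exists>a. s = mat a")
  case True
  then obtain a where a: "s = mat a" by blast
  have "a ^ 2 = 1" using s(1) by (simp add: a det_mat2 mat_def power2_eq_square)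
  then have "a = 1 \<or> a = -1" by (simp add: power2_eq_1_iff)
  then have "a = -1" using s(2) a by auto
  have "trace (s ** M) = - trace M" for M
    by (simp add: a \<open>a = -1\<close> trace_mat2 mat2_mult mat_def)
  then have tr: "trace M + trace (s ** M) = 0" for M by simp
  have "x + x \<noteq> 0" using x(2) by (simp only: mult_2 not_False_eq_True)
  then have "\<not> (trace M = x \<and> trace (s ** M) = x)" for M using tr[of M] by auto
  then have "{M. det M = 1 \<and> trace M = x \<and> trace (s ** M) = x} = {}" by simp
  then have "trace_pairs x s = 0" unfolding trace_pairs_def by (simp only: card.empty)
  then show ?thesis using eigenpairs_le[of s] by simp
next
  case False
  then show ?thesis using trace_pairs_eigenpairs_nonscalar x(1) s by blast
qed

text \<open>The product of the off-diagonal entries is \<open>m (x - m) - 1\<close>, where \<open>m\<close> is the upper left entry. It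
  is nonzero for elliptic \<open>x\<close>, so \<open>m\<close> and a nonzero upper right entry can be chosen freely.\<close>

lemma card_elliptic_class:
  fixes x :: "'k::{field,finite}"
  assumes x: "elliptic x"
  shows "card {M :: 'k ^ 2 ^ 2. det M = 1 \<and> trace M = x} = CARD('k) * (CARD('k) - 1)"
proof -
  let ?A = "{M :: 'k ^ 2 ^ 2. det M = 1 \<and> trace M = x}"
  let ?g = "\<lambda>(m, n). vector [vector [m, n], vector [(m * (x - m) - 1) / n, x - m]] :: 'k ^ 2 ^ 2"
  have nz: "m * (x - m) - 1 \<noteq> 0" for m
  proof
    assume "m * (x - m) - 1 = 0"
    then have "m ^ 2 - x * m + 1 = 0" by (simp add: algebra_simps power2_eq_square)
    then show False using x unfolding elliptic_def by blast
  qed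
  have M: "M $ 2 $ 2 = x - M $ 1 $ 1" "M $ 1 $ 2 * M $ 2 $ 1 = M $ 1 $ 1 * (x - M $ 1 $ 1) - 1"
    if "M \<in> ?A" for M
  proof -
    show 22: "M $ 2 $ 2 = x - M $ 1 $ 1" using that by (auto simp: trace_mat2)
    show "M $ 1 $ 2 * M $ 2 $ 1 = M $ 1 $ 1 * (x - M $ 1 $ 1) - 1"
      using that unfolding 22[symmetric] by (simp add: det_mat2 algebra_simps)
  qed
  have M12: "M $ 1 $ 2 \<noteq> 0" if "M \<in> ?A" for M using M(2)[OF that] nz[of "M $ 1 $ 1"] by auto
  have "bij_betw (\<lambda>M. (M $ 1 $ 1, M $ 1 $ 2)) ?A (UNIV \<times> (UNIV - {0}))"
  proof (rule bij_betw_byWitness[where f' = ?g])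
    show "\<forall>M\<in>?A. ?g (M $ 1 $ 1, M $ 1 $ 2) = M"
    proof
      fix M assume A: "M \<in> ?A"
      show "?g (M $ 1 $ 1, M $ 1 $ 2) = M"
        using M(1)[OF A] M12[OF A] by (simp add: mat2_eq_iff flip: M(2)[OF A])
    qed
    show "(\<lambda>M. (M $ 1 $ 1, M $ 1 $ 2)) ` ?A \<subseteq> UNIV \<times> (UNIV - {0})" using M12 by auto
    show "?g ` (UNIV \<times> (UNIV - {0})) \<subseteq> ?A" by (auto simp: det_mat2 trace_mat2)
  qed auto
  then show ?thesis
    using bij_betw_same_card by (fastforce simp: card_cartesian_product card_Diff_subset)
qed

text \<open>The first column and one further entry determine the matrix: the upper right entry if the upper
  left one is nonzero, the lower right entry otherwise.\<close>

lemma card_SL2_le: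
  "card {M :: 'k::{field,finite} ^ 2 ^ 2. det M = 1} \<le> (CARD('k) ^ 2 - 1) * CARD('k)"
proof -
  let ?A = "{M :: 'k ^ 2 ^ 2. det M = 1}"
  let ?f = "\<lambda>M :: 'k ^ 2 ^ 2. (M *v axis 1 1, if M $ 1 $ 1 = 0 then M $ 2 $ 2 else M $ 1 $ 2)"
  have e: "(axis 1 1 :: 'k ^ 2) \<noteq> 0" by (simp add: axis_eq_0_iff)
  have "card ?A \<le> card ({v :: 'k ^ 2. v \<noteq> 0} \<times> (UNIV :: 'k set))"
  proof (rule card_inj_on_le[of ?f])
    show "inj_on ?f ?A"
    proof (rule inj_onI)
      fix M N assume "M \<in> ?A" "N \<in> ?A" and f: "?f M = ?f N"
      then have d: "M $ 1 $ 1 * M $ 2 $ 2 - M $ 1 $ 2 * M $ 2 $ 1 = 1"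
        "N $ 1 $ 1 * N $ 2 $ 2 - N $ 1 $ 2 * N $ 2 $ 1 = 1" by (simp_all add: det_mat2)
      have c: "M $ 1 $ 1 = N $ 1 $ 1" "M $ 2 $ 1 = N $ 2 $ 1"
        using f by (simp_all add: vec_eq_iff forall_2 mat2_mult_vec axis_def)
      show "M = N"
      proof (cases "M $ 1 $ 1 = 0")
        case True
        then have "M $ 2 $ 2 = N $ 2 $ 2" using f c by simp
        moreover have "M $ 1 $ 2 * M $ 2 $ 1 = -1" "N $ 1 $ 2 * M $ 2 $ 1 = -1"
          using arg_cong[OF d(1), of uminus] arg_cong[OF d(2), of uminus] True c by simp_all
        then have "M $ 1 $ 2 * M $ 2 $ 1 = N $ 1 $ 2 * M $ 2 $ 1" "M $ 2 $ 1 \<noteq> 0" by auto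
        ultimately show ?thesis using c by (simp add: mat2_eq_iff)
      next
        case False
        then have "M $ 1 $ 2 = N $ 1 $ 2" using f c by simp
        moreover have "M $ 1 $ 1 * M $ 2 $ 2 = M $ 1 $ 1 * N $ 2 $ 2"
          using d c calculation by (simp add: diff_eq_eq)
        ultimately show ?thesis using c False by (simp add: mat2_eq_iff)
      qed
    qed
    show "?f ` ?A \<subseteq> {v. v \<noteq> 0} \<times> UNIV" using SL2_nonzero[where 'k='k] e by auto
  qed simp
  then show ?thesis by (simp add: card_cartesian_product card_nonzero)
qed

section \<open>The mean and the variance of the number of elements with given trace\<close>

lemma eigenpairs_alt:
  "eigenpairs s = (\<Sum>a\<in>UNIV. card {v :: 'k::{field,finite} ^ 2. v \<noteq> 0 \<and> s *v v = a *s v})"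
proof -
  have "{(a, v). v \<noteq> 0 \<and> s *v v = a *s v} = (SIGMA a : UNIV. {v. v \<noteq> 0 \<and> s *v v = a *s v})"
    by auto
  then show ?thesis by (simp add: eigenpairs_def)
qed

lemma sum_eigenpairs:
  fixes S :: "('k::{field,finite} ^ 2 ^ 2) set"
  assumes S: "sharp S"
  shows "(\<Sum>s\<in>S. eigenpairs s) = (CARD('k) - 1) * (CARD('k) ^ 2 - 1)"
proof -
  have "(\<Sum>s\<in>S. eigenpairs s) = (\<Sum>a\<in>UNIV. \<Sum>s\<in>S. card {v. v \<noteq> 0 \<and> s *v v = a *s v})"
    unfolding eigenpairs_alt by (rule sum.swap)
  also have "\<dots> = (\<Sum>a\<in>UNIV. card {v :: 'k ^ 2. v \<noteq> 0 \<and> a *s v \<noteq> 0})"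
    by (simp only: sum_card_agreements[OF S])
  also have "\<dots> = (\<Sum>a\<in>UNIV. if (a :: 'k) = 0 then 0 else CARD('k) ^ 2 - 1)"
    by (intro sum.cong refl) (auto simp: card_nonzero)
  also have "\<dots> = (\<Sum>a\<in>UNIV - {0 :: 'k}. CARD('k) ^ 2 - 1)"
    by (rule sum.mono_neutral_cong_right) auto
  finally show ?thesis by (simp add: card_Diff_subset)
qed

lemma sharp_trace_ne_2:
  fixes S :: "('k::{field,finite} ^ 2 ^ 2) set"
  assumes S: "sharp S" and "mat 1 \<in> S" "s \<in> S" "s \<noteq> mat 1"
  shows "trace s \<noteq> 2"
proof
  assume "trace s = 2"
  moreover have "det (s - mat 1) = det s + 1 - trace s"
    by (simp add: det_mat2 mat_def trace_mat2 algebra_simps)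
  ultimately have "det (s - mat 1) = 0" using sharp_det[OF S \<open>s \<in> S\<close>] by simp
  then have "of_nat (card {v. v \<noteq> 0 \<and> (s - mat 1) *v v = 0}) = (-1 :: 'k)"
    by (simp add: card_kernel)
  then have "{v. v \<noteq> 0 \<and> (s - mat 1) *v v = 0} \<noteq> {}" by (intro notI) (simp only: card.empty, simp)
  then obtain v where v: "v \<noteq> 0" "(s - mat 1) *v v = 0" by blast
  then have "s *v v = mat 1 *v v" by (simp add: matrix_vector_mult_diff_rdistrib)
  then show False using sharp_eqI[OF S \<open>s \<in> S\<close> \<open>mat 1 \<in> S\<close> v(1)] assms(4) by blast
qed

text \<open>Summing \<open>trace_pairs_eigenpairs\<close> over \<open>s \<noteq> 1\<close> bounds the number of trace pairs in terms of
  the number of eigenpairs, and \<open>sum_eigenpairs\<close> gives the latter exactly.\<close>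

lemma sum_trace_pairs:
  fixes S :: "('k::{field,finite} ^ 2 ^ 2) set"
  assumes S: "sharp S" and one: "mat 1 \<in> S" and x: "elliptic x" "2 * x \<noteq> 0"
  shows "(\<Sum>s\<in>S. trace_pairs x s) \<le> CARD('k) * (CARD('k) - 1) * (CARD('k) + 2)"
proof -
  define q where "q = int CARD('k)"
  have q: "q > 1" using CARD_field_gt_1[where 'k='k] by (simp add: q_def)
  have q1: "int (CARD('k) - 1) = q - 1" "int (CARD('k) ^ 2 - 1) = q ^ 2 - 1"
    using CARD_field_gt_1[where 'k='k] by (simp_all add: q_def of_nat_diff)
  let ?S = "S - {mat 1}"
  define T where "T = int (\<Sum>s\<in>?S. trace_pairs x s)"
  have "(\<Sum>s\<in>?S. (CARD('k) - 1) * trace_pairs x s + eigenpairs s) \<le> (\<Sum>s\<in>?S. CARD('k) ^ 2 - 1)"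
    using trace_pairs_eigenpairs[OF x] sharp_det[OF S] sharp_trace_ne_2[OF S one]
    by (intro sum_mono) simp
  also have "\<dots> = (CARD('k) ^ 2 - 2) * (CARD('k) ^ 2 - 1)"
    using one by (simp add: card_sharp[OF S] numeral_2_eq_2)
  finally have "(CARD('k) - 1) * (\<Sum>s\<in>?S. trace_pairs x s) + (\<Sum>s\<in>?S. eigenpairs s)
      \<le> (CARD('k) ^ 2 - 2) * (CARD('k) ^ 2 - 1)"
    by (simp only: sum.distrib sum_distrib_left)
  then have "int ((CARD('k) - 1) * (\<Sum>s\<in>?S. trace_pairs x s) + (\<Sum>s\<in>?S. eigenpairs s))
      \<le> int ((CARD('k) ^ 2 - 2) * (CARD('k) ^ 2 - 1))"
    by (simp only: of_nat_le_iff)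
  moreover have "int (CARD('k) ^ 2 - 2) = q ^ 2 - 2"
  proof -
    have "2 ^ 2 \<le> CARD('k) ^ 2" using CARD_field_gt_1[where 'k='k] by (intro power_mono) auto
    then show ?thesis by (simp add: q_def of_nat_diff)
  qed
  ultimately have 1: "(q - 1) * T + int (\<Sum>s\<in>?S. eigenpairs s) \<le> (q ^ 2 - 2) * (q ^ 2 - 1)"
    by (simp only: of_nat_add of_nat_mult q1 T_def)
  have "int (eigenpairs (mat 1 :: 'k ^ 2 ^ 2)) \<le> q ^ 2 - 1"
    using eigenpairs_le[of "mat 1 :: 'k ^ 2 ^ 2"] by (simp only: q1(2)[symmetric] of_nat_le_iff)
  moreover have "int (\<Sum>s\<in>S. eigenpairs s) = (q - 1) * (q ^ 2 - 1)"
    by (simp only: sum_eigenpairs[OF S] of_nat_mult q1)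
  moreover have "(\<Sum>s\<in>S. eigenpairs s) = eigenpairs (mat 1 :: 'k ^ 2 ^ 2) + (\<Sum>s\<in>?S. eigenpairs s)"
    using one by (intro sum.remove) simp_all
  ultimately have "int (\<Sum>s\<in>?S. eigenpairs s) \<ge> (q - 2) * (q ^ 2 - 1)" by (simp add: algebra_simps)
  with 1 have "(q - 1) * T \<le> (q - 1) * (q * (q ^ 2 - 1))"
    by (simp add: algebra_simps power2_eq_square)
  then have T: "T \<le> q * (q ^ 2 - 1)" using q by simp
  have "trace_pairs x (mat 1 :: 'k ^ 2 ^ 2) = CARD('k) * (CARD('k) - 1)"
    unfolding trace_pairs_def using card_elliptic_class[OF x(1)] by simp
  then have tp1: "int (trace_pairs x (mat 1 :: 'k ^ 2 ^ 2)) = q * (q - 1)"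
    by (simp only: of_nat_mult q1) (simp add: q_def)
  have "(\<Sum>s\<in>S. trace_pairs x s) = trace_pairs x (mat 1) + (\<Sum>s\<in>?S. trace_pairs x s)"
    using one by (intro sum.remove) simp_all
  then have "int (\<Sum>s\<in>S. trace_pairs x s) = q * (q - 1) + T" by (simp only: of_nat_add tp1 T_def)
  also have "\<dots> \<le> q * (q - 1) * (q + 2)" using T by (simp add: algebra_simps power2_eq_square)
  also have "\<dots> = int (CARD('k) * (CARD('k) - 1) * (CARD('k) + 2))"
    by (simp only: of_nat_mult of_nat_add q1) (simp add: q_def)
  finally show ?thesis by (simp only: of_nat_le_iff)
qed

lemma card_SL2_shift:
  fixes t :: "'k::{field,finite} ^ 2 ^ 2"
  assumes "det t = 1"
  shows "card {M. det M = 1 \<and> R (t ** M)} = card {M. det M = 1 \<and> R M}"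
proof -
  obtain B where B: "det B = 1" "B ** t = mat 1" "t ** B = mat 1" using SL2_inverse[OF assms] by blast
  have "bij_betw (\<lambda>M. t ** M) {M. det M = 1 \<and> R (t ** M)} {M. det M = 1 \<and> R M}"
    by (rule bij_betw_byWitness[where f' = "\<lambda>M. B ** M"])
      (auto simp: matrix_mul_assoc B det_mul assms)
  then show ?thesis by (rule bij_betw_same_card)
qed

lemma first_moment:
  fixes S :: "('k::{field,finite} ^ 2 ^ 2) set"
  assumes S: "sharp S" and x: "elliptic x"
  shows "(\<Sum>M | det M = 1. card {s \<in> S. trace (s ** M) = x})
    = (CARD('k) ^ 2 - 1) * (CARD('k) * (CARD('k) - 1))"
proof -
  have "(\<Sum>M | det M = 1. card {s \<in> S. trace (s ** M) = x})
      = (\<Sum>M | det M = 1. \<Sum>s\<in>S. if trace (s ** M) = x then 1 else 0)"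
    by (simp add: sum.If_cases Int_def)
  also have "\<dots> = (\<Sum>s\<in>S. \<Sum>M | det M = 1. if trace (s ** M) = x then 1 else 0)"
    by (rule sum.swap)
  also have "\<dots> = (\<Sum>s\<in>S. card {M. det M = 1 \<and> trace (s ** M) = x})"
    by (simp add: sum.If_cases Int_def)
  also have "\<dots> = (\<Sum>s\<in>S. CARD('k) * (CARD('k) - 1))"
    by (intro sum.cong refl)
      (simp add: card_SL2_shift[OF sharp_det[OF S], where R = "\<lambda>M. trace M = x"] card_elliptic_class[OF x])
  finally show ?thesis by (simp add: card_sharp[OF S])
qed

text \<open>Expanding the square gives a sum over \<open>s, t \<in> S\<close>. Substituting \<open>t\<^sup>-\<^sup>1 M\<close> for \<open>M\<close> makes the terms with
  a fixed \<open>t\<close> into the sum of \<open>sum_trace_pairs\<close> for the translate \<open>S t\<^sup>-\<^sup>1\<close>, which contains \<open>1\<close>.\<close>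

lemma second_moment:
  fixes S :: "('k::{field,finite} ^ 2 ^ 2) set"
  assumes S: "sharp S" and x: "elliptic x" "2 * x \<noteq> 0"
  shows "(\<Sum>M | det M = 1. card {s \<in> S. trace (s ** M) = x} ^ 2)
    \<le> (CARD('k) ^ 2 - 1) * (CARD('k) * (CARD('k) - 1) * (CARD('k) + 2))"
proof -
  let ?G = "{M :: 'k ^ 2 ^ 2. det M = 1}"
  have "(\<Sum>M\<in>?G. card {s \<in> S. trace (s ** M) = x} ^ 2)
      = (\<Sum>M\<in>?G. \<Sum>t\<in>S. \<Sum>s\<in>S. if trace (t ** M) = x \<and> trace (s ** M) = x then 1 else 0)"
  proof (intro sum.cong refl)
    fix M
    have "card {s \<in> S. trace (s ** M) = x} ^ 2
        = (\<Sum>t\<in>S. if trace (t ** M) = x then 1 else 0) * (\<Sum>s\<in>S. if trace (s ** M) = x then 1 else 0)"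
      by (simp add: sum.If_cases Int_def power2_eq_square)
    also have "\<dots> = (\<Sum>t\<in>S. \<Sum>s\<in>S. if trace (t ** M) = x \<and> trace (s ** M) = x then 1 else 0)"
      unfolding sum_product by (intro sum.cong refl) simp
    finally show "card {s \<in> S. trace (s ** M) = x} ^ 2 = \<dots>" .
  qed
  also have "\<dots> = (\<Sum>t\<in>S. \<Sum>M\<in>?G. \<Sum>s\<in>S. if trace (t ** M) = x \<and> trace (s ** M) = x then 1 else 0)"
    by (rule sum.swap)
  also have "\<dots> = (\<Sum>t\<in>S. \<Sum>s\<in>S. \<Sum>M\<in>?G. if trace (t ** M) = x \<and> trace (s ** M) = x then 1 else 0)"
    by (rule sum.cong[OF refl]) (rule sum.swap)
  also have "\<dots> = (\<Sum>t\<in>S. \<Sum>s\<in>S. card {M. det M = 1 \<and> trace (t ** M) = x \<and> trace (s ** M) = x})"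
    by (simp add: sum.If_cases Int_def)
  also have "\<dots> \<le> (\<Sum>t\<in>S. CARD('k) * (CARD('k) - 1) * (CARD('k) + 2))"
  proof (rule sum_mono)
    fix t assume t: "t \<in> S"
    then obtain B where B: "det B = 1" "B ** t = mat 1" "t ** B = mat 1"
      using SL2_inverse[OF sharp_det[OF S]] by blast
    have "card {M. det M = 1 \<and> trace (t ** M) = x \<and> trace (s ** M) = x} = trace_pairs x (s ** B)" for s
    proof -
      have eq: "(s ** B) ** (t ** M) = s ** M" for M
      proof -
        have "(s ** B) ** (t ** M) = s ** (B ** t) ** M" by (simp only: matrix_mul_assoc)
        then show ?thesis by (simp add: B)
      qed
      have "card {M. det M = 1 \<and> trace (t ** M) = x \<and> trace (s ** M) = x}
          = card {M. det M = 1 \<and> trace (t ** M) = x \<and> trace ((s ** B) ** (t ** M)) = x}"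
        by (simp only: eq)
      also have "\<dots> = trace_pairs x (s ** B)"
        unfolding trace_pairs_def
        by (rule card_SL2_shift[where R = "\<lambda>M. trace M = x \<and> trace ((s ** B) ** M) = x"])
          (rule sharp_det[OF S t])
      finally show ?thesis .
    qed
    then have "(\<Sum>s\<in>S. card {M. det M = 1 \<and> trace (t ** M) = x \<and> trace (s ** M) = x})
        = (\<Sum>s\<in>S. trace_pairs x (s ** B))" by simp
    also have "\<dots> = (\<Sum>u\<in>(\<lambda>s. s ** B) ` S. trace_pairs x u)"
      by (subst sum.reindex) (auto intro: inj_on_subset[OF inj_mult_right[OF B(1)]])
    also have "\<dots> \<le> CARD('k) * (CARD('k) - 1) * (CARD('k) + 2)"
    proof (rule sum_trace_pairs[OF sharp_translate[OF S B(1)] _ x])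
      show "mat 1 \<in> (\<lambda>s. s ** B) ` S" using t B(3) by (intro image_eqI[of _ _ t]) simp_all
    qed
    finally show "(\<Sum>s\<in>S. card {M. det M = 1 \<and> trace (t ** M) = x \<and> trace (s ** M) = x})
      \<le> CARD('k) * (CARD('k) - 1) * (CARD('k) + 2)" .
  qed
  finally show ?thesis by (simp add: card_sharp[OF S])
qed

lemma CHAR_eq_CARD:
  assumes p: "prime CARD('k::{field,finite})"
  shows "CHAR('k) = CARD('k)"
proof -
  have "CHAR('k) dvd CARD('k)"
    using of_nat_CARD[where 'k='k] unfolding of_nat_eq_0_iff_char_dvd .
  moreover have "prime CHAR('k)" by (intro prime_CHAR_semidom finite_imp_CHAR_pos) auto
  ultimately show ?thesis using p primes_dvd_imp_eq by blast
qed

lemma of_nat_exhausts: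
  assumes p: "prime CARD('k::{field,finite})"
  obtains r where "r < CARD('k)" "x = (of_nat r :: 'k)"
proof -
  have "inj_on (of_nat :: nat \<Rightarrow> 'k) {..<CARD('k)}"
  proof (rule linorder_inj_onI')
    fix i j assume ij: "i \<in> {..<CARD('k)}" "j \<in> {..<CARD('k)}" "i < j"
    then have "\<not> CARD('k) dvd j - i" by (auto dest: dvd_imp_le)
    then have "of_nat (j - i) \<noteq> (0 :: 'k)" unfolding of_nat_eq_0_iff_char_dvd CHAR_eq_CARD[OF p] .
    then show "(of_nat i :: 'k) \<noteq> of_nat j" using ij by (simp add: of_nat_diff)
  qed
  then have "card (of_nat ` {..<CARD('k)} :: 'k set) = CARD('k)" by (simp add: card_image)
  then have "of_nat ` {..<CARD('k)} = (UNIV :: 'k set)" by (intro card_subset_eq) auto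
  then have "x \<in> of_nat ` {..<CARD('k)}" by simp
  then show thesis using that by blast
qed

text \<open>All values \<open>N M\<close> lie in the residue class of \<open>r\<close> modulo \<open>q\<close>, and a multiple \<open>n\<close> of \<open>q\<close> satisfies
  \<open>n (n - q) \<ge> 0\<close>. The sum of these inequalities for \<open>n = N M - r\<close> involves only the first two
  moments and the order of the group.\<close>

lemma elliptic_residue_bound:
  fixes S :: "('k::{field,finite} ^ 2 ^ 2) set" and x :: 'k and r :: nat
  assumes S: "sharp S" and x: "elliptic x" "2 * x \<noteq> 0" and p: "prime CARD('k)"
    and r: "of_nat r = x ^ 2 - 3"
  shows "int r * (int CARD('k) - 2 - int r) \<le> 2 * (int CARD('k) - 1)"
proof -
  let ?G = "{M :: 'k ^ 2 ^ 2. det M = 1}"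
  define N where "N M = int (card {s \<in> S. trace (s ** M) = x})" for M
  define q where "q = int CARD('k)"
  define \<rho> where "\<rho> = int r"
  have q: "q > 1" using CARD_field_gt_1[where 'k='k] by (simp add: q_def)
  have q1: "int (CARD('k) - 1) = q - 1" "int (CARD('k) ^ 2 - 1) = q ^ 2 - 1"
    using CARD_field_gt_1[where 'k='k] by (simp_all add: q_def of_nat_diff)
  have pp: "primepow CARD('k)" using p by (rule primepow_prime)
  have CHAR: "CHAR('k) = CARD('k)" using p by (rule CHAR_eq_CARD)
  have nonneg: "(N M - \<rho>) * (N M - \<rho> - q) \<ge> 0" if M: "M \<in> ?G" for M
  proof -
    have detM: "det M = 1" using M by simp
    have "{u \<in> (\<lambda>s. s ** M) ` S. trace u = x} = (\<lambda>s. s ** M) ` {s \<in> S. trace (s ** M) = x}" by auto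
    moreover have "card ((\<lambda>s. s ** M) ` {s \<in> S. trace (s ** M) = x}) = card {s \<in> S. trace (s ** M) = x}"
      by (intro card_image inj_on_subset[OF inj_mult_right[OF detM]]) simp
    ultimately have "card {u \<in> (\<lambda>s. s ** M) ` S. trace u = x} = card {s \<in> S. trace (s ** M) = x}"
      by simp
    then have "of_nat (card {s \<in> S. trace (s ** M) = x}) = (of_nat r :: 'k)"
      using elliptic_trace_count[OF sharp_translate[OF S detM] x(1) pp] r by simp
    then have "(of_int (N M - \<rho>) :: 'k) = 0" by (simp add: N_def \<rho>_def)
    then have "q dvd N M - \<rho>"
      using of_int_eq_0_iff_char_dvd[where 'a='k, of "N M - \<rho>"] by (simp add: CHAR q_def)
    then obtain k where k: "N M - \<rho> = q * k" by blast
    have "k * (k - 1) \<ge> 0" by (cases "k \<le> 0") (auto simp: zero_le_mult_iff)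
    then have "q ^ 2 * (k * (k - 1)) \<ge> 0" by (simp add: zero_le_mult_iff)
    then show ?thesis unfolding k by (simp add: algebra_simps power2_eq_square)
  qed
  have m1: "(\<Sum>M\<in>?G. N M) = (q ^ 2 - 1) * (q * (q - 1))"
    using arg_cong[OF first_moment[OF S x(1)], of int]
    by (simp only: of_nat_sum of_nat_mult q1 N_def) (simp add: q_def)
  have m2: "(\<Sum>M\<in>?G. N M ^ 2) \<le> (q ^ 2 - 1) * (q * (q - 1) * (q + 2))"
  proof -
    have "int (\<Sum>M\<in>?G. card {s \<in> S. trace (s ** M) = x} ^ 2)
      \<le> int ((CARD('k) ^ 2 - 1) * (CARD('k) * (CARD('k) - 1) * (CARD('k) + 2)))"
      using second_moment[OF S x] by (simp only: of_nat_le_iff)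
    then show ?thesis
      by (simp only: of_nat_sum of_nat_mult of_nat_power of_nat_add q1 N_def) (simp add: q_def)
  qed
  have m0: "int (card ?G) \<le> (q ^ 2 - 1) * q"
  proof -
    have "int (card ?G) \<le> int ((CARD('k) ^ 2 - 1) * CARD('k))"
      using card_SL2_le[where 'k='k] by (simp only: of_nat_le_iff)
    then show ?thesis by (simp only: of_nat_mult q1) (simp add: q_def)
  qed
  have "0 \<le> (\<Sum>M\<in>?G. (N M - \<rho>) * (N M - \<rho> - q))" by (rule sum_nonneg) (rule nonneg)
  also have "\<dots> = (\<Sum>M\<in>?G. N M ^ 2 - (2 * \<rho> + q) * N M + \<rho> * (\<rho> + q))"
    by (intro sum.cong refl) (simp add: algebra_simps power2_eq_square)
  also have "\<dots> = (\<Sum>M\<in>?G. N M ^ 2) - (2 * \<rho> + q) * (\<Sum>M\<in>?G. N M) + int (card ?G) * (\<rho> * (\<rho> + q))"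
    by (simp add: sum.distrib sum_subtractf sum_distrib_left)
  also have "\<dots> \<le> (q ^ 2 - 1) * (q * (q - 1) * (q + 2))
      - (2 * \<rho> + q) * ((q ^ 2 - 1) * (q * (q - 1))) + (q ^ 2 - 1) * q * (\<rho> * (\<rho> + q))"
    unfolding m1 using q by (intro add_mono diff_mono m2 mult_right_mono m0) (auto simp: \<rho>_def)
  also have "\<dots> = ((q ^ 2 - 1) * q) * (2 * (q - 1) - \<rho> * (q - 2 - \<rho>))"
    by (simp add: algebra_simps power2_eq_square)
  finally have "0 \<le> ((q ^ 2 - 1) * q) * (2 * (q - 1) - \<rho> * (q - 2 - \<rho>))" .
  moreover have "(q ^ 2 - 1) * q > 0" using q by (intro mult_pos_pos) (simp_all add: one_less_power)
  ultimately have "0 \<le> 2 * (q - 1) - \<rho> * (q - 2 - \<rho>)"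
    by (simp only: zero_le_mult_iff) linarith
  then show ?thesis by (simp add: q_def \<rho>_def)
qed

section \<open>The primes from 13 on\<close>

lemma elliptic_of_nat:
  assumes p: "prime CARD('k::{field,finite})" and n: "n \<le> CARD('k)"
    and no_root: "list_all (\<lambda>w. (w * w + (CARD('k) - n) * w + 1) mod CARD('k) \<noteq> 0) [0..<CARD('k)]"
  shows "elliptic (of_nat n :: 'k)"
  unfolding elliptic_def
proof
  fix w :: 'k
  obtain r where r: "r < CARD('k)" "w = of_nat r" using of_nat_exhausts[OF p] .
  have "(r * r + (CARD('k) - n) * r + 1) mod CARD('k) \<noteq> 0"
    using no_root r(1) by (simp only: list_all_iff set_upt atLeastLessThan_iff le0 simp_thms)
  then have nz: "of_nat (r * r + (CARD('k) - n) * r + 1) \<noteq> (0 :: 'k)"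
    unfolding of_nat_eq_0_iff_char_dvd CHAR_eq_CARD[OF p] dvd_eq_mod_eq_0 .
  have eq: "(of_nat (r * r + (CARD('k) - n) * r + 1) :: 'k) = w ^ 2 - of_nat n * w + 1"
    by (simp only: of_nat_add of_nat_mult of_nat_diff[OF n] of_nat_CARD r(2))
      (simp add: power2_eq_square)
  show "w ^ 2 - of_nat n * w + 1 \<noteq> 0" using nz unfolding eq .
qed

lemma two_neq_0:
  assumes p: "prime CARD('k::{field,finite})" and "CARD('k) \<noteq> 2"
  shows "(2 :: 'k) \<noteq> 0"
proof
  assume "(2 :: 'k) = 0"
  then have "of_nat 2 = (0 :: 'k)" by simp
  then have "CARD('k) dvd 2" unfolding of_nat_eq_0_iff_char_dvd CHAR_eq_CARD[OF p] .
  then show False using primes_dvd_imp_eq[OF p two_is_prime_nat] assms(2) by blast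
qed

lemma residue_bound_of_nat:
  fixes S :: "('k::{field,finite} ^ 2 ^ 2) set"
  assumes S: "sharp S" and p: "prime CARD('k)" "CARD('k) \<noteq> 2"
    and n: "0 < n" "n < CARD('k)"
    and no_root: "list_all (\<lambda>w. (w * w + (CARD('k) - n) * w + 1) mod CARD('k) \<noteq> 0) [0..<CARD('k)]"
    and r: "(r + 3) mod CARD('k) = (n * n) mod CARD('k)"
  shows "int r * (int CARD('k) - 2 - int r) \<le> 2 * (int CARD('k) - 1)"
proof (rule elliptic_residue_bound[OF S _ _ p(1)])
  show "elliptic (of_nat n :: 'k)" using p(1) less_imp_le[OF n(2)] no_root by (rule elliptic_of_nat)
  have "of_nat n \<noteq> (0 :: 'k)"
    unfolding of_nat_eq_0_iff_char_dvd CHAR_eq_CARD[OF p(1)] using n nat_dvd_not_less by blast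
  then show "2 * of_nat n \<noteq> (0 :: 'k)" using two_neq_0[OF p] by simp
  have mod: "(of_nat (m mod CARD('k)) :: 'k) = of_nat m" for m
  proof -
    have "(of_nat (CARD('k) * (m div CARD('k)) + m mod CARD('k)) :: 'k) = of_nat (m mod CARD('k))"
      by (simp only: of_nat_add of_nat_mult of_nat_CARD mult_zero_left add_0)
    then show ?thesis by simp
  qed
  have "(of_nat (r + 3) :: 'k) = of_nat ((r + 3) mod CARD('k))" by (rule mod[symmetric])
  also have "\<dots> = of_nat (n * n)" unfolding r by (rule mod)
  finally show "of_nat r = (of_nat n :: 'k) ^ 2 - 3" by (simp add: power2_eq_square eq_diff_eq)
qed

text \<open>The inequality of \<open>elliptic_residue_bound\<close> fails for \<open>3 \<le> r \<le> p - 5\<close> if \<open>p > 13\<close>. The other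
  residues belong to \<open>x\<^sup>2 \<in> {-1, 0, 1, 2, 3, 4, 5}\<close>, where \<open>4\<close> is not the square of an elliptic element.
  The other six values have at most \<open>12\<close> square roots, and there are at least \<open>14\<close> elliptic elements
  if \<open>p \<ge> 29\<close>.\<close>

lemma sharp_CARD_less_29:
  fixes S :: "('k::{field,finite} ^ 2 ^ 2) set"
  assumes S: "sharp S" and p: "prime CARD('k)"
  shows "CARD('k) < 29"
proof (rule ccontr)
  assume "\<not> ?thesis"
  then have p29: "CARD('k) \<ge> 29" by simp
  let ?U = "{-1, 0, 1, 2, 3, 5 :: 'k}" and ?E = "{x :: 'k. elliptic x}"
  have "card (\<Union>u\<in>?U. {x. x ^ 2 = u}) \<le> (\<Sum>u\<in>?U. card {x :: 'k. x ^ 2 = u})"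
    by (rule card_UN_le) simp
  also have "\<dots> \<le> (\<Sum>u\<in>?U. 2)" by (rule sum_mono) (rule card_square_roots)
  also have "\<dots> \<le> 12" by (simp add: card_insert_if)
  finally have "card (\<Union>u\<in>?U. {x :: 'k. x ^ 2 = u}) < card ?E"
    using card_elliptic[where 'k='k] p29 by simp
  then have "\<not> ?E \<subseteq> (\<Union>u\<in>?U. {x. x ^ 2 = u})" using card_mono[of "\<Union>u\<in>?U. {x. x ^ 2 = u}" ?E] by auto
  then obtain x where x: "elliptic x" "x ^ 2 \<notin> ?U" by auto
  have "x ^ 2 \<noteq> 4" using elliptic_square_ne_4[OF x(1)] .
  have "x \<noteq> 0" using x(2) by auto
  then have x2: "2 * x \<noteq> 0" using two_neq_0[OF p] p29 by simp
  obtain r where r: "r < CARD('k)" "x ^ 2 - 3 = of_nat r" using of_nat_exhausts[OF p] .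
  have x2r: "x ^ 2 = of_nat r + 3" using r(2) by (simp add: algebra_simps)
  have "r \<noteq> j" if "j \<in> {0, 1, 2}" for j
  proof
    assume "r = j"
    then have "x ^ 2 \<in> {3, 4, 5}" using that x2r by auto
    then show False using x(2) \<open>x ^ 2 \<noteq> 4\<close> by auto
  qed
  then have "r \<noteq> 0" "r \<noteq> 1" "r \<noteq> 2" by simp_all
  moreover have top: "r + j \<noteq> CARD('k)" if "j \<in> {1, 2, 3, 4}" for j
  proof
    assume "r + j = CARD('k)"
    then have "(of_nat (r + j) :: 'k) = 0" by (simp only: of_nat_CARD)
    then have "(of_nat r :: 'k) = - of_nat j" by (simp add: eq_neg_iff_add_eq_0)
    then have "x ^ 2 = 3 - of_nat j" unfolding x2r by simp
    then have "x ^ 2 \<in> ?U" using that by auto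
    then show False using x(2) by blast
  qed
  have "r + 1 \<noteq> CARD('k)" "r + 2 \<noteq> CARD('k)" "r + 3 \<noteq> CARD('k)" "r + 4 \<noteq> CARD('k)"
    by (intro top, simp)+
  ultimately have r': "3 \<le> r" "r + 5 \<le> CARD('k)" using r(1) by linarith+
  have "(int r - 3) * (int CARD('k) - 5 - int r) \<ge> 0" using r' by simp
  then have "3 * (int CARD('k) - 5) \<le> int r * (int CARD('k) - 2 - int r)" by (simp add: algebra_simps)
  also have "\<dots> \<le> 2 * (int CARD('k) - 1)"
    using elliptic_residue_bound[OF S x(1) x2 p] r(2) by simp
  finally show False using p29 by simp
qed

text \<open>For \<open>p = 13, 17, 19, 23\<close> the elements \<open>3, 3, 4, 3\<close> are elliptic, and their residues \<open>r = x\<^sup>2 - 3\<close>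
  are \<open>6, 6, 13, 6\<close>. The coefficient \<open>-x\<close> is represented by \<open>p - x\<close>, to stay within the natural numbers.\<close>

lemma no_root_13: "list_all (\<lambda>w. (w * w + (13 - 3) * w + 1) mod 13 \<noteq> (0 :: nat)) [0..<13]"
  by code_simp

lemma no_root_17: "list_all (\<lambda>w. (w * w + (17 - 3) * w + 1) mod 17 \<noteq> (0 :: nat)) [0..<17]"
  by code_simp

lemma no_root_19: "list_all (\<lambda>w. (w * w + (19 - 4) * w + 1) mod 19 \<noteq> (0 :: nat)) [0..<19]"
  by code_simp

lemma no_root_23: "list_all (\<lambda>w. (w * w + (23 - 3) * w + 1) mod 23 \<noteq> (0 :: nat)) [0..<23]"
  by code_simp

lemma primes_below_29:
  fixes p :: nat
  assumes "prime p" "p < 29"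
  shows "p \<in> {2, 3, 5, 7, 11, 13, 17, 19, 23}"
proof -
  have "\<not> 2 dvd p \<or> p = 2" "\<not> 3 dvd p \<or> p = 3" "\<not> 5 dvd p \<or> p = 5"
    using primes_dvd_imp_eq[of 2 p] primes_dvd_imp_eq[of 3 p] primes_dvd_imp_eq[of 5 p] assms(1)
    by auto
  moreover have "p > 1" using assms(1) by (rule prime_gt_1_nat)
  ultimately show ?thesis using assms(2) unfolding insert_iff empty_iff by presburger
qed

theorem sharp_CARD_in:
  fixes S :: "('k::{field,finite} ^ 2 ^ 2) set"
  assumes S: "sharp S" and q: "primepow CARD('k)"
  shows "CARD('k) \<in> {2, 3, 5, 7, 11}"
proof -
  have p: "prime CARD('k)" by (rule sharp_imp_prime_CARD[OF S q])
  note bound = residue_bound_of_nat[OF S p]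
  have "CARD('k) \<noteq> 13"
  proof
    assume q: "CARD('k) = 13"
    have "int 6 * (int 13 - 2 - int 6) \<le> 2 * (int 13 - 1)"
      by (rule bound[unfolded q, OF _ _ _ no_root_13]) simp_all
    then show False by simp
  qed
  moreover have "CARD('k) \<noteq> 17"
  proof
    assume q: "CARD('k) = 17"
    have "int 6 * (int 17 - 2 - int 6) \<le> 2 * (int 17 - 1)"
      by (rule bound[unfolded q, OF _ _ _ no_root_17]) simp_all
    then show False by simp
  qed
  moreover have "CARD('k) \<noteq> 19"
  proof
    assume q: "CARD('k) = 19"
    have "int 13 * (int 19 - 2 - int 13) \<le> 2 * (int 19 - 1)"
      by (rule bound[unfolded q, OF _ _ _ no_root_19]) simp_all
    then show False by simp
  qed
  moreover have "CARD('k) \<noteq> 23"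
  proof
    assume q: "CARD('k) = 23"
    have "int 6 * (int 23 - 2 - int 6) \<le> 2 * (int 23 - 1)"
      by (rule bound[unfolded q, OF _ _ _ no_root_23]) simp_all
    then show False by simp
  qed
  ultimately show ?thesis using primes_below_29[OF p sharp_CARD_less_29[OF S p]] by blast
qed

section \<open>Existence for q = 2, 3, 5, 7, 11\<close>

text \<open>A quadruple \<open>(a, b, c, d)\<close> stands for the matrix with rows \<open>(a, b)\<close> and \<open>(c, d)\<close> modulo \<open>p\<close>.\<close>

type_synonym quad = "int \<times> int \<times> int \<times> int"

text \<open>For matrices \<open>g\<close>, \<open>h\<close> of determinant \<open>1\<close> given by the two quadruples and the diagonal matrix \<open>T\<close> with
  entries \<open>r\<close>, \<open>1 / r\<close>, we have \<open>det (T g - h) = 2 - r A - D / r\<close>. The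
  condition that this is nonzero, multiplied by \<open>- r\<close>, is required for all nonzero \<open>r\<close> modulo \<open>p\<close>.\<close>

fun separated_pair :: "int \<Rightarrow> quad \<Rightarrow> quad \<Rightarrow> bool" where
  "separated_pair p (a, b, c, d) (a', b', c', d') \<longleftrightarrow>
    (a, b, c, d) = (a', b', c', d') \<or>
    (let A = (a * d' - b * c') mod p; D = (d * a' - c * b') mod p
     in list_all (\<lambda>r. (r * (r * A - 2) + D) mod p \<noteq> 0) [1..p - 1])"

text \<open>Such a list represents the cosets \<open>T g\<close>, where \<open>T\<close> is the group of diagonal matrices of determinant
  \<open>1\<close>, that make up a sharply transitive set. The number of cosets is \<open>(q\<^sup>2 - 1) / (q - 1)\<close>.\<close>

definition transversal :: "int \<Rightarrow> quad list \<Rightarrow> bool" where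
  "transversal p R \<longleftrightarrow> distinct R \<and> int (length R) = p + 1 \<and>
    list_all (\<lambda>(a, b, c, d). (a * d - b * c) mod p = 1) R \<and>
    list_all (\<lambda>g. list_all (separated_pair p g) R) R"

text \<open>For odd \<open>p\<close> the set is the union of \<open>T\<close>, the antidiagonal matrices of determinant \<open>1\<close>, and two
  double cosets of \<open>T\<close>. On a double coset of matrices with nonzero entries the product \<open>\<kappa>\<close> of
  the diagonal entries is constant, and so is the quadratic character of the product of the upper two entries.
  Hence its cosets are represented by \<open>(1, b, (\<kappa> - 1) / b, \<kappa>)\<close>, where \<open>b\<close> runs through the squares or
  through the nonsquares. The pairs of values of \<open>\<kappa>\<close> for squares and for nonsquares are \<open>(2, 2)\<close> for
  \<open>p = 3\<close>, \<open>(3, 3)\<close> for \<open>p = 5\<close>, \<open>(5, 3)\<close> for \<open>p = 7\<close> and \<open>(10, 2)\<close> for \<open>p = 11\<close>. For \<open>p = 2\<close> the torus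
  is trivial and the set is the cyclic subgroup of order \<open>3\<close>.\<close>

lemma transversal_2: "transversal 2 [(1, 0, 0, 1), (0, 1, 1, 1), (1, 1, 1, 0)]"
  by code_simp

lemma transversal_3: "transversal 3 [(1, 0, 0, 1), (0, 1, -1, 0), (1, 1, 1, 2), (1, 2, 2, 2)]"
  by code_simp

lemma transversal_5: "transversal 5
    [(1, 0, 0, 1), (0, 1, -1, 0), (1, 1, 2, 3), (1, 4, 3, 3), (1, 2, 1, 3), (1, 3, 4, 3)]"
  by code_simp

lemma transversal_7: "transversal 7
    [(1, 0, 0, 1), (0, 1, -1, 0), (1, 1, 4, 5), (1, 2, 2, 5), (1, 4, 1, 5),
     (1, 3, 3, 3), (1, 5, 6, 3), (1, 6, 5, 3)]"
  by code_simp

lemma transversal_11: "transversal 11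
    [(1, 0, 0, 1), (0, 1, -1, 0),
     (1, 1, 9, 10), (1, 3, 3, 10), (1, 4, 5, 10), (1, 5, 4, 10), (1, 9, 1, 10),
     (1, 2, 6, 2), (1, 6, 2, 2), (1, 7, 8, 2), (1, 8, 7, 2), (1, 10, 10, 2)]"
  by code_simp

text \<open>Nonsingular differences make \<open>s \<mapsto> s v\<close> injective on \<open>S\<close> for every nonzero \<open>v\<close>, and by its
  size it is onto the nonzero vectors.\<close>

lemma sharp_if_separated:
  fixes S :: "('k::{field,finite} ^ 2 ^ 2) set"
  assumes det: "\<And>s. s \<in> S \<Longrightarrow> det s = 1"
    and sep: "\<And>s t. s \<in> S \<Longrightarrow> t \<in> S \<Longrightarrow> s \<noteq> t \<Longrightarrow> det (s - t) \<noteq> 0"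
    and card: "card S = CARD('k) ^ 2 - 1"
  shows "sharp S"
  unfolding sharply_transitive_SL2_iff
proof (intro conjI ballI allI impI)
  fix v w :: "'k ^ 2" assume v: "v \<noteq> 0" and w: "w \<noteq> 0"
  have inj: "inj_on (\<lambda>s. s *v v) S"
  proof (rule inj_onI, rule ccontr)
    fix s t assume st: "s \<in> S" "t \<in> S" "s *v v = t *v v" "s \<noteq> t"
    then have "(s - t) *v v = 0" by (simp add: matrix_vector_mult_diff_rdistrib)
    then show False using det_nonzero_kernel[OF sep[OF st(1,2,4)]] v by blast
  qed
  have "{v. v \<noteq> 0} = (\<lambda>s. s *v v) ` S"
  proof (rule sym, rule card_subset_eq)
    show "(\<lambda>s. s *v v) ` S \<subseteq> {v. v \<noteq> 0}" using SL2_nonzero[OF det] v by auto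
    show "card ((\<lambda>s. s *v v) ` S) = card {v :: 'k ^ 2. v \<noteq> 0}"
      by (simp only: card_image[OF inj] card card_nonzero)
  qed simp
  then have "w \<in> (\<lambda>s. s *v v) ` S" using w by (simp only: set_eq_iff mem_Collect_eq)
  then obtain s where s: "s \<in> S" "s *v v = w" by (elim imageE) simp
  show "\<exists>!s. s \<in> S \<and> s *v v = w"
  proof (rule ex1I[of _ s])
    show "s \<in> S \<and> s *v v = w" using s by blast
    fix t assume t: "t \<in> S \<and> t *v v = w"
    show "t = s" by (rule inj_onD[OF inj]) (simp_all add: s t)
  qed
qed (rule det)

lemma sharp_if_transversal:
  assumes p: "prime CARD('k::{field,finite})" and R: "transversal (int CARD('k)) R"
  shows "\<exists>S :: ('k ^ 2 ^ 2) set. sharp S"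
proof -
  let ?p = "int CARD('k)"
  define m :: "'k \<times> quad \<Rightarrow> 'k ^ 2 ^ 2" where
    "m = (\<lambda>(t, a, b, c, d). vector [vector [t * of_int a, t * of_int b], vector [of_int c / t, of_int d / t]])"
  define D where "D = (UNIV - {0 :: 'k}) \<times> set R"
  have zero_iff: "(of_int z :: 'k) = 0 \<longleftrightarrow> z mod ?p = 0" for z
    using of_int_eq_0_iff_char_dvd[where 'a='k, of z] by (simp add: CHAR_eq_CARD[OF p] dvd_eq_mod_eq_0)
  have mod: "(of_int (z mod ?p) :: 'k) = of_int z" for z
  proof -
    have "(of_int (z mod ?p - z) :: 'k) = 0" unfolding zero_iff by (simp add: mod_diff_left_eq)
    then show ?thesis by simp
  qed
  have Rdet: "(a * d - b * c) mod ?p = 1" if "(a, b, c, d) \<in> set R" for a b c d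
    using R that unfolding transversal_def list_all_iff by fast
  have Rsep: "separated_pair ?p g g'" if "g \<in> set R" "g' \<in> set R" for g g'
    using R that unfolding transversal_def list_all_iff by blast
  have Rcard: "card (set R) = CARD('k) + 1"
    using R by (simp add: transversal_def distinct_card)
  have det: "det (m x) = 1" if "x \<in> D" for x
  proof -
    obtain t a b c d where x: "x = (t, a, b, c, d)" by (cases x)
    have "t \<noteq> 0" using that by (simp add: x D_def)
    have "(a * d - b * c) mod ?p = 1" using that by (intro Rdet) (simp add: x D_def)
    then have "(of_int (a * d - b * c) :: 'k) = 1" using mod[of "a * d - b * c"] by simp
    then show ?thesis using \<open>t \<noteq> 0\<close> by (simp add: x m_def det_mat2)
  qed
  have sep: "det (m x - m y) \<noteq> 0" if x: "x \<in> D" and y: "y \<in> D" and "x \<noteq> y" for x y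
  proof
    assume 0: "det (m x - m y) = 0"
    obtain t a b c d where xx: "x = (t, a, b, c, d)" by (cases x)
    obtain u a' b' c' d' where yy: "y = (u, a', b', c', d')" by (cases y)
    have tu: "t \<noteq> 0" "u \<noteq> 0" using x y by (simp_all add: xx yy D_def)
    define r where "r = t / u"
    have r: "r \<noteq> 0" "t = r * u" using tu by (simp_all add: r_def)
    let ?A = "a * d' - b * c'" and ?B = "d * a' - c * b'"
    define \<alpha> \<beta> :: 'k where "\<alpha> = of_int ?A" and "\<beta> = of_int ?B"
    have "det (m x - m y) = det (m x) + det (m y) - r * of_int ?A - of_int ?B / r"
      using r tu by (simp add: xx yy m_def det_mat2 field_simps)
    then have "2 - r * of_int ?A - of_int ?B / r = 0" using 0 det[OF x] det[OF y] by simp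
    then have "r * (2 - r * \<alpha> - \<beta> / r) = 0" unfolding \<alpha>_def \<beta>_def by simp
    moreover have "r * (2 - r * \<alpha> - \<beta> / r) = - (r * (r * \<alpha> - 2) + \<beta>)"
      using r(1) by (simp add: right_diff_distrib)
    ultimately have quad: "r * (r * \<alpha> - 2) + \<beta> = 0" by (simp only: neg_equal_0_iff_equal)
    show False
    proof (cases "(a, b, c, d) = (a', b', c', d')")
      case True
      have "(a * d - b * c) mod ?p = 1" using x by (intro Rdet) (simp add: xx D_def)
      then have "?A mod ?p = 1" "?B mod ?p = 1" using True by (simp_all add: mult.commute)
      then have "\<alpha> = 1" "\<beta> = 1" using mod[of ?A] mod[of ?B] by (simp_all add: \<alpha>_def \<beta>_def)
      then have "(r - 1) ^ 2 = 0" using quad by (simp add: algebra_simps power2_eq_square)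
      then have "t = u" using r(2) by simp
      then show False using True \<open>x \<noteq> y\<close> xx yy by simp
    next
      case False
      obtain n where n: "n < CARD('k)" "r = of_nat n" using of_nat_exhausts[OF p] .
      have "n \<noteq> 0" using n r(1) by (intro notI) simp
      then have "int n \<in> set [1..?p - 1]" using n by simp
      moreover have all: "\<forall>\<rho>\<in>set [1..?p - 1]. (\<rho> * (\<rho> * (?A mod ?p) - 2) + ?B mod ?p) mod ?p \<noteq> 0"
      proof -
        have "separated_pair ?p (a, b, c, d) (a', b', c', d')"
          using x y by (intro Rsep) (simp_all add: xx yy D_def)
        then show ?thesis using False by (simp only: separated_pair.simps Let_def list_all_iff simp_thms)
      qed
      ultimately have "(int n * (int n * (?A mod ?p) - 2) + ?B mod ?p) mod ?p \<noteq> 0"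
        by (intro bspec[OF all])
      then have "(of_int (int n * (int n * (?A mod ?p) - 2) + ?B mod ?p) :: 'k) \<noteq> 0"
        by (simp only: zero_iff not_False_eq_True)
      moreover have "(of_int (int n * (int n * (?A mod ?p) - 2) + ?B mod ?p) :: 'k)
          = r * (r * \<alpha> - 2) + \<beta>"
        unfolding \<alpha>_def \<beta>_def
        by (simp only: of_int_add of_int_mult of_int_diff[of _ 2] mod of_int_of_nat_eq n(2) of_int_numeral)
      ultimately show False using quad by simp
    qed
  qed
  have "inj_on m D"
  proof (rule inj_onI, rule ccontr)
    fix x y assume "x \<in> D" "y \<in> D" "m x = m y" "x \<noteq> y"
    then show False using sep[of x y] by (simp add: det_mat2)
  qed
  then have "card (m ` D) = (CARD('k) - 1) * (CARD('k) + 1)"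
    by (simp add: card_image D_def card_cartesian_product card_Diff_subset Rcard)
  also have "\<dots> = CARD('k) ^ 2 - 1" by (simp add: power2_eq_square diff_mult_distrib)
  finally have card: "card (m ` D) = CARD('k) ^ 2 - 1" .
  have "sharp (m ` D)"
  proof (rule sharp_if_separated[OF _ _ card])
    show "det s = 1" if "s \<in> m ` D" for s
      using that by (elim imageE) (simp only: det)
    show "det (s - t) \<noteq> 0" if "s \<in> m ` D" "t \<in> m ` D" "s \<noteq> t" for s t
    proof -
      obtain x y where "x \<in> D" "y \<in> D" "s = m x" "t = m y"
        using \<open>s \<in> m ` D\<close> \<open>t \<in> m ` D\<close> by (elim imageE)
      then show ?thesis using sep[of x y] \<open>s \<noteq> t\<close> by (cases "x = y") simp_all
    qed
  qed
  then show ?thesis by blast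
qed

theorem exists_sharp:
  assumes "CARD('k::{field,finite}) \<in> {2, 3, 5, 7, 11}"
  shows "\<exists>S :: ('k ^ 2 ^ 2) set. sharp S"
proof -
  consider "CARD('k) = 2" | "CARD('k) = 3" | "CARD('k) = 5" | "CARD('k) = 7" | "CARD('k) = 11"
    using assms by blast
  then show ?thesis
  proof cases
    case 1
    then have "prime CARD('k)" "int CARD('k) = 2" by simp_all
    then show ?thesis using transversal_2 by (intro sharp_if_transversal[where 'k = 'k]) (simp_all only:)
  next
    case 2
    then have "prime CARD('k)" "int CARD('k) = 3" by simp_all
    then show ?thesis using transversal_3 by (intro sharp_if_transversal[where 'k = 'k]) (simp_all only:)
  next
    case 3
    then have "prime CARD('k)" "int CARD('k) = 5" by simp_all
    then show ?thesis using transversal_5 by (intro sharp_if_transversal[where 'k = 'k]) (simp_all only:)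
  next
    case 4
    then have "prime CARD('k)" "int CARD('k) = 7" by simp_all
    then show ?thesis using transversal_7 by (intro sharp_if_transversal[where 'k = 'k]) (simp_all only:)
  next
    case 5
    then have "prime CARD('k)" "int CARD('k) = 11" by simp_all
    then show ?thesis using transversal_11 by (intro sharp_if_transversal[where 'k = 'k]) (simp_all only:)
  qed
qed

theorem mainTheorem2:
  fixes q :: nat
  assumes "primepow q" and "CARD('k::{field,finite}) = q"
  shows "(\<exists>S. sharply_transitive (SL2 :: ('k ^ 2 ^ 2) monoid) nonzero_vectors natural_action S)
           \<longleftrightarrow> q \<in> {2, 3, 5, 7, 11}"
proof -
  have pp: "primepow CARD('k)" using assms by simp
  show ?thesis using sharp_CARD_in[OF _ pp] exists_sharp[where 'k = 'k] unfolding assms(2) by iprover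
qed

end
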